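(* Let $n\ge2$, and for $m\in\mathbb N_+$, $\tau=T/m$, $t_i=i\tau$, let $(U^i)_{0\le i\le m}$ be the fully discrete scheme $$U^{i+1}-U^i+\tau A_n^2U^{i+1}=\tau A_nF_n(U^{i+1})+\sqrt{n/\pi}\,\Sigma_n(U^i)(\beta_{t_{i+1}}-\beta_{t_i}),\quad 0\le i\le m-1,$$ $U^0=(u_0(h),\dots,u_0((n-1)h))^\top$, $h=\pi/n$, with the notation of the context. Let $\sigma$ be continuously differentiable with $\sigma(x)\neq0$ for any $x\in\mathbb R$. Then for sufficiently small $\tau>0$ (depending on $n$) and each $i\in\{1,\dots,m\}$, the law of $U^i$ is absolutely continuous with respect to the Lebesgue measure on $\mathbb R^{n-1}$.
   Context: $T>0$; $f(x)=x^3-x$; $\sigma:\mathbb R\to\mathbb R$ is bounded and globally Lipschitz; $u_0:(0,\pi)\to\mathbb R$ is nonrandom and continuous. $A_n\in\mathbb R^{(n-1)\times(n-1)}$ is $\frac{n^2}{\pi^2}$ times the tridiagonal matrix with $-2$ on the diagonal and $1$ on the two off-diagonals. For $a\in\mathbb R^{n-1}$, $F_n(a)=(f(a_1),\dots,f(a_{n-1}))^\top$ and $\Sigma_n(a)=\mathrm{diag}(\sigma(a_1),\dots,\sigma(a_{n-1}))$. $\beta_t=(\beta_t^1,\dots,\beta_t^{n-1})^\top$, $\beta^k_t=\sqrt{n/\pi}\,(W(t,(k+1)h)-W(t,kh))$, where $W$ is a Brownian sheet on $[0,T]\times(0,\pi)$; thus $\beta$ is a standard $(n-1)$-dimensional Brownian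 motion. For small $\tau$ the implicit equation for $U^{i+1}$ is uniquely solvable. *)

theory Defs
  imports "HOL-Probability.Probability"
begin

text \<open>Vectors in \<open>R^(n-1)\<close> are elements of \<open>real ^ 'd\<close> where \<open>'d\<close> is a finite linearly ordered
  type with \<open>n - 1\<close> elements. The position of an index in the order, counted from 1, identifies
  \<open>'d\<close> with \<open>{1..n-1}\<close>.\<close>

definition pos :: "'d::{finite,linorder} \<Rightarrow> nat" where
  "pos k = card {j. j \<le> k}"

definition mesh :: "nat \<Rightarrow> real" where
  "mesh n = pi / real n"

definition A_mat :: "nat \<Rightarrow> real ^ ('d::{finite,linorder}) ^ ('d::{finite,linorder})" where
  "A_mat n = (\<chi> k l. (real n)\<^sup>2 / pi\<^sup>2 *
     (if pos k = pos l then - 2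
      else if pos k = pos l + 1 \<or> pos l = pos k + 1 then 1
      else 0))"

definition f_nl :: "real \<Rightarrow> real" where
  "f_nl x = x ^ 3 - x"

definition F_vec :: "real ^ 'd \<Rightarrow> real ^ 'd" where
  "F_vec a = (\<chi> k. f_nl (a $ k))"

definition Sigma_mat :: "(real \<Rightarrow> real) \<Rightarrow> real ^ 'd \<Rightarrow> real ^ 'd ^ 'd" where
  "Sigma_mat \<sigma> a = (\<chi> k l. if k = l then \<sigma> (a $ k) else 0)"

text \<open>Centered Gaussian variables are allowed to be degenerate, since the Brownian sheet vanishes
  almost surely on the axes.\<close>

definition centered_gaussian :: "'a measure \<Rightarrow> ('a \<Rightarrow> real) \<Rightarrow> bool" where
  "centered_gaussian M X \<longleftrightarrow> X \<in> borel_measurable M \<and>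
     ((AE \<omega> in M. X \<omega> = 0) \<or>
      (\<exists>s>0. distributed M lborel X (\<lambda>x. ennreal (normal_density 0 s x))))"

text \<open>A Brownian sheet on \<open>[0,T] \<times> [0,L]\<close>: a centered Gaussian process (all finite linear
  combinations are centered Gaussian) with covariance \<open>min s t * min x y\<close> and almost surely
  continuous paths. The spatial interval is closed, because the last component of \<open>beta\<close> below
  evaluates the sheet at the end point \<open>pi\<close>.\<close>

definition brownian_sheet ::
  "'a measure \<Rightarrow> real \<Rightarrow> real \<Rightarrow> (real \<Rightarrow> real \<Rightarrow> 'a \<Rightarrow> real) \<Rightarrow> bool" where
  "brownian_sheet M T L W \<longleftrightarrow>
     (\<forall>P c. finite P \<longrightarrow> P \<subseteq> {0..T} \<times> {0..L} \<longrightarrow>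
        centered_gaussian M (\<lambda>\<omega>. \<Sum>p\<in>P. c p * W (fst p) (snd p) \<omega>)) \<and>
     (\<forall>s\<in>{0..T}. \<forall>t\<in>{0..T}. \<forall>x\<in>{0..L}. \<forall>y\<in>{0..L}.
        (\<integral>\<omega>. W s x \<omega> * W t y \<omega> \<partial>M) = min s t * min x y) \<and>
     (AE \<omega> in M. continuous_on ({0..T} \<times> {0..L}) (\<lambda>p. W (fst p) (snd p) \<omega>))"

definition beta ::
  "nat \<Rightarrow> (real \<Rightarrow> real \<Rightarrow> 'a \<Rightarrow> real) \<Rightarrow> real \<Rightarrow> 'a \<Rightarrow> real ^ ('d::{finite,linorder})" where
  "beta n W t \<omega> = (\<chi> k. sqrt (real n / pi) *
     (W t (real (pos k + 1) * mesh n) \<omega> - W t (real (pos k) * mesh n) \<omega>))"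

definition fully_discrete_scheme ::
  "'a measure \<Rightarrow> real \<Rightarrow> nat \<Rightarrow> nat \<Rightarrow> (real \<Rightarrow> real) \<Rightarrow> (real \<Rightarrow> real) \<Rightarrow>
   (real \<Rightarrow> real \<Rightarrow> 'a \<Rightarrow> real) \<Rightarrow> (nat \<Rightarrow> 'a \<Rightarrow> real ^ ('d::{finite,linorder})) \<Rightarrow> bool" where
  "fully_discrete_scheme M T n m \<sigma> u\<^sub>0 W U \<longleftrightarrow>
     (let \<tau> = T / real m; A = A_mat n :: real ^ ('d::{finite,linorder}) ^ ('d::{finite,linorder}) in
       (\<forall>i\<le>m. U i \<in> borel_measurable M) \<and>
       (AE \<omega> in M. U 0 \<omega> = (\<chi> k. u\<^sub>0 (real (pos k) * mesh n))) \<and>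
       (\<forall>i<m. AE \<omega> in M.
          U (Suc i) \<omega> - U i \<omega> + \<tau> *\<^sub>R ((A ** A) *v U (Suc i) \<omega>) =
          \<tau> *\<^sub>R (A *v F_vec (U (Suc i) \<omega>)) +
          sqrt (real n / pi) *\<^sub>R
            (Sigma_mat \<sigma> (U i \<omega>) *v
              (beta n W (real (Suc i) * \<tau>) \<omega> - beta n W (real i * \<tau>) \<omega>))))"

end

theory Submission imports Defs begin

text \<open>The scheme reads \<open>\<Phi>(U\<^sub>i\<^sub>+\<^sub>1) = U\<^sub>i + c \<Sigma>(U\<^sub>i) \<Delta>\<beta>\<^sub>i\<close> with \<open>\<Phi>(x) = x + \<tau> A\<^sup>2 x - \<tau> A F(x)\<close>. For small \<open>\<tau>\<close> the
  map \<open>\<Phi>\<close> is injective, hence by invariance of domain it has a Borel left inverse, so \<open>U\<^sub>i\<close> is almost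
  surely a function of the earlier increments and independent of \<open>\<Delta>\<beta>\<^sub>i\<close>. The increment \<open>\<Delta>\<beta>\<^sub>i\<close> has a density
  and \<open>\<Sigma>(v)\<close> is invertible for every \<open>v\<close>, so conditioning on \<open>U\<^sub>i\<close> shows that the right-hand side almost
  surely avoids any given null set. Finally \<open>\<Phi>\<close> is differentiable, so it maps a null set \<open>N\<close> into a null
  set; as the right-hand side avoids the latter, \<open>U\<^sub>i\<^sub>+\<^sub>1\<close> avoids \<open>N\<close>. No regularity of the inverse of \<open>\<Phi>\<close>
  enters this last step.\<close>

section \<open>Independence of uncorrelated Gaussian variables\<close>

text \<open>Independence of several variables reduces to the one-dimensional uniqueness theorem for
  characteristic functions: adding a constant to the bounded weight \<open>Z\<close> makes it positive, and
  after normalisation \<open>X\<close> has the same characteristic function under the reweighted measure.\<close>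

lemma (in prob_space) weighted_char_imp_indep_real:
  fixes X Z :: "'a \<Rightarrow> real"
  assumes X[measurable]: "X \<in> borel_measurable M" and Z[measurable]: "Z \<in> borel_measurable M"
    and bound: "\<And>\<omega>. \<omega> \<in> space M \<Longrightarrow> \<bar>Z \<omega>\<bar> \<le> C"
    and char_eq: "\<And>s. (CLINT \<omega>|M. complex_of_real (Z \<omega>) * iexp (s * X \<omega>)) =
                  complex_of_real a * (CLINT \<omega>|M. iexp (s * X \<omega>))"
    and B[measurable]: "B \<in> sets borel"
  shows "expectation (\<lambda>\<omega>. Z \<omega> * indicator B (X \<omega>)) = a * prob (X -` B \<inter> space M)"
proof -
  have C0: "0 \<le> C"
    using bound not_empty by force
  have intZ: "integrable M Z"
    by (rule integrable_const_bound[where B=C]) (use bound in auto)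
  have Ea: "expectation Z = a"
    using char_eq[of 0] by (simp add: prob_space)
  have "expectation (\<lambda>_. -C) \<le> expectation Z"
    by (rule integral_mono[OF _ intZ]) (use bound in \<open>auto simp: abs_le_iff minus_le_iff\<close>)
  then have k: "C + 1 + a \<ge> 1" by (simp add: prob_space Ea)
  \<comment> \<open>The shift is \<open>C + 1\<close> rather than \<open>C\<close>: the mean
    \<open>a\<close> of \<open>Z\<close> is at least \<open>-C\<close>, so the normaliser
    \<open>C + 1 + a\<close> is at least 1, even when \<open>Z\<close> is constantly
    \<open>-C\<close>.\<close>
  define w where "w \<omega> = (C + 1 + Z \<omega>) / (C + 1 + a)" for \<omega>
  have w[measurable]: "w \<in> borel_measurable M" unfolding w_def by measurable
  have w0: "AE \<omega> in M. 0 \<le> w \<omega>"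
    using bound k by (auto simp: w_def abs_le_iff intro!: AE_I2 divide_nonneg_nonneg) (smt (verit))+
  have intw: "integrable M w" unfolding w_def using intZ by simp
  have Ew: "expectation w = 1"
    unfolding w_def using k intZ by (simp add: prob_space Ea)
  define N where "N = density M w"
  interpret N: prob_space N
  proof
    show "emeasure N (space N) = 1"
      unfolding N_def by (simp add: emeasure_density nn_integral_eq_integral intw w0 Ew cong: nn_integral_cong)
  qed
  have [measurable]: "X \<in> borel_measurable N" by (simp add: N_def)
  have intX: "integrable M (\<lambda>\<omega>. iexp (s * X \<omega>))" for s
    by (rule integrable_const_bound[where B=1]) auto
  have intZX: "integrable M (\<lambda>\<omega>. complex_of_real (Z \<omega>) * iexp (s * X \<omega>))" for s
    by (rule integrable_const_bound[where B=C]) (use bound in \<open>auto simp: norm_mult\<close>)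
  have "distr N borel X = distr M borel X"
  proof (rule Levy_uniqueness)
    show "real_distribution (distr N borel X)" by (rule N.real_distribution_distr) simp
    show "real_distribution (distr M borel X)" by (rule real_distribution_distr) simp
    show "char (distr N borel X) = char (distr M borel X)"
    proof
      fix s
      have "char (distr N borel X) s = (CLINT \<omega>|N. iexp (s * X \<omega>))"
        by (simp add: char_def integral_distr)
      also have "\<dots> = (CLINT \<omega>|M. w \<omega> *\<^sub>R iexp (s * X \<omega>))"
        unfolding N_def using w0 by (subst integral_density) auto
      also have "\<dots> = (CLINT \<omega>|M. (complex_of_real (C + 1) * iexp (s * X \<omega>) + complex_of_real (Z \<omega>) * iexp (s * X \<omega>)) / complex_of_real (C + 1 + a))"
        by (intro Bochner_Integration.integral_cong) (auto simp: w_def scaleR_conv_of_real field_simps)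
      also have "\<dots> = (complex_of_real (C + 1) * (CLINT \<omega>|M. iexp (s * X \<omega>)) + (CLINT \<omega>|M. complex_of_real (Z \<omega>) * iexp (s * X \<omega>))) / complex_of_real (C + 1 + a)"
        using intX[of s] intZX[of s]
        by (subst integral_divide_zero, subst Bochner_Integration.integral_add) auto
      also have "\<dots> = complex_of_real (C + 1 + a) * (CLINT \<omega>|M. iexp (s * X \<omega>)) / complex_of_real (C + 1 + a)"
        unfolding char_eq by (simp add: algebra_simps)
      also have "\<dots> = (CLINT \<omega>|M. iexp (s * X \<omega>))"
      proof -
        have "complex_of_real (C + 1 + a) \<noteq> 0" using k by (subst of_real_eq_0_iff) linarith
        then show ?thesis by simp
      qed
      also have "\<dots> = char (distr M borel X) s"
        by (simp add: char_def integral_distr)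
      finally show "char (distr N borel X) s = char (distr M borel X) s" .
    qed
  qed
  then have "measure (distr N borel X) B = measure (distr M borel X) B" by simp
  then have NM: "measure N (X -` B \<inter> space M) = prob (X -` B \<inter> space M)"
    by (simp add: measure_distr N_def)
  have intB: "integrable M (\<lambda>\<omega>. indicator B (X \<omega>) :: real)"
    by (rule integrable_const_bound[where B=1]) (auto simp: indicator_def)
  have intZB: "integrable M (\<lambda>\<omega>. Z \<omega> * indicator B (X \<omega>) :: real)"
    by (rule integrable_const_bound[where B=C]) (use bound C0 in \<open>auto simp: indicator_def\<close>)
  have EB: "expectation (\<lambda>\<omega>. indicat_real B (X \<omega>)) = prob (X -` B \<inter> space M)"
  proof -
    have "expectation (\<lambda>\<omega>. indicat_real B (X \<omega>)) = expectation (indicat_real (X -` B \<inter> space M))"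
      by (intro Bochner_Integration.integral_cong) (auto simp: indicator_def)
    then show ?thesis by simp
  qed
  \<comment> \<open>Reweighting leaves the probability of the event unchanged. Written out and
    multiplied by the normaliser, this equality loses its \<open>C + 1\<close> terms, and the claim
    about \<open>Z\<close> alone remains.\<close>
  have "measure N (X -` B \<inter> space M) = (LINT \<omega>|N. indicator (X -` B \<inter> space M) \<omega>)"
    by (simp add: N_def)
  also have "\<dots> = expectation (\<lambda>\<omega>. w \<omega> *\<^sub>R indicator (X -` B \<inter> space M) \<omega>)"
    unfolding N_def using w0 by (subst integral_density) auto
  also have "\<dots> = expectation (\<lambda>\<omega>. ((C + 1) * indicator B (X \<omega>) + Z \<omega> * indicator B (X \<omega>)) / (C + 1 + a))"
    by (intro Bochner_Integration.integral_cong) (auto simp: w_def indicator_def)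
  also have "\<dots> = ((C + 1) * prob (X -` B \<inter> space M) + expectation (\<lambda>\<omega>. Z \<omega> * indicator B (X \<omega>))) / (C + 1 + a)"
    using intB intZB by (subst integral_divide_zero, subst Bochner_Integration.integral_add) (auto simp: EB)
  finally show ?thesis unfolding NM using k by (simp add: field_simps)
qed

text \<open>Conjugating the hypothesis at frequency \<open>-s\<close> gives the same hypothesis for
  the conjugate of \<open>Z\<close>. Real and imaginary parts are combinations of the two, so the
  real version applies to each. Complex weights occur below because a weight may contain exponential
  factors of other variables.\<close>

lemma (in prob_space) weighted_char_imp_indep_complex:
  fixes X :: "'a \<Rightarrow> real" and Z :: "'a \<Rightarrow> complex"
  assumes X[measurable]: "X \<in> borel_measurable M" and Z[measurable]: "Z \<in> borel_measurable M"
    and bound: "\<And>\<omega>. \<omega> \<in> space M \<Longrightarrow> norm (Z \<omega>) \<le> C"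
    and char_eq: "\<And>s. (CLINT \<omega>|M. Z \<omega> * iexp (s * X \<omega>)) = a * (CLINT \<omega>|M. iexp (s * X \<omega>))"
    and B[measurable]: "B \<in> sets borel"
  shows "(CLINT \<omega>|M. Z \<omega> * indicator B (X \<omega>)) = a * complex_of_real (prob (X -` B \<inter> space M))"
proof -
  have C0: "0 \<le> C"
    using bound not_empty norm_ge_zero order_trans by blast
  have intZX: "integrable M (\<lambda>\<omega>. Z \<omega> * iexp (s * X \<omega>))" for s
    by (rule integrable_const_bound[where B=C]) (use bound in \<open>auto simp: norm_mult\<close>)
  have [measurable]: "(\<lambda>\<omega>. cnj (Z \<omega>)) \<in> borel_measurable M"
    by (rule borel_measurable_continuous_on[OF _ Z]) (intro continuous_intros)
  have intZX': "integrable M (\<lambda>\<omega>. cnj (Z \<omega>) * iexp (s * X \<omega>))" for s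
    by (rule integrable_const_bound[where B=C]) (use bound in \<open>auto simp: norm_mult\<close>)
  have conj: "(CLINT \<omega>|M. cnj (Z \<omega>) * iexp (s * X \<omega>)) = cnj a * (CLINT \<omega>|M. iexp (s * X \<omega>))" for s
  proof -
    have "(CLINT \<omega>|M. cnj (Z \<omega>) * iexp (s * X \<omega>)) = (CLINT \<omega>|M. cnj (Z \<omega> * iexp ((- s) * X \<omega>)))"
      by (intro Bochner_Integration.integral_cong) (auto simp: exp_cnj)
    also have "\<dots> = cnj (a * (CLINT \<omega>|M. iexp ((- s) * X \<omega>)))"
      unfolding Bochner_Integration.integral_cnj char_eq ..
    also have "\<dots> = cnj a * (CLINT \<omega>|M. cnj (iexp ((- s) * X \<omega>)))"
      by (simp only: Bochner_Integration.integral_cnj complex_cnj_mult)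
    also have "(CLINT \<omega>|M. cnj (iexp ((- s) * X \<omega>))) = (CLINT \<omega>|M. iexp (s * X \<omega>))"
      by (intro Bochner_Integration.integral_cong) (auto simp: exp_cnj)
    finally show ?thesis .
  qed
  have re: "expectation (\<lambda>\<omega>. Re (Z \<omega>) * indicator B (X \<omega>)) = Re a * prob (X -` B \<inter> space M)"
  proof (rule weighted_char_imp_indep_real)
    fix s
    have "(CLINT \<omega>|M. complex_of_real (Re (Z \<omega>)) * iexp (s * X \<omega>)) =
      (CLINT \<omega>|M. (Z \<omega> * iexp (s * X \<omega>) + cnj (Z \<omega>) * iexp (s * X \<omega>)) / 2)"
      by (intro Bochner_Integration.integral_cong refl) (simp add: complex_eq_iff algebra_simps)
    also have "\<dots> = (a + cnj a) / 2 * (CLINT \<omega>|M. iexp (s * X \<omega>))"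
      by (simp only: integral_divide_zero Bochner_Integration.integral_add[OF intZX intZX'] char_eq conj)
         (simp add: algebra_simps add_divide_distrib)
    also have "(a + cnj a) / 2 = complex_of_real (Re a)" by (simp add: complex_eq_iff)
    finally show "(CLINT \<omega>|M. complex_of_real (Re (Z \<omega>)) * iexp (s * X \<omega>)) =
       complex_of_real (Re a) * (CLINT \<omega>|M. iexp (s * X \<omega>))" .
  next
    show "\<bar>Re (Z \<omega>)\<bar> \<le> C" if "\<omega> \<in> space M" for \<omega>
      using bound[OF that] abs_Re_le_cmod[of "Z \<omega>"] by linarith
  qed auto
  have im: "expectation (\<lambda>\<omega>. Im (Z \<omega>) * indicator B (X \<omega>)) = Im a * prob (X -` B \<inter> space M)"
  proof (rule weighted_char_imp_indep_real)
    fix s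
    have "(CLINT \<omega>|M. complex_of_real (Im (Z \<omega>)) * iexp (s * X \<omega>)) =
      (CLINT \<omega>|M. (Z \<omega> * iexp (s * X \<omega>) - cnj (Z \<omega>) * iexp (s * X \<omega>)) / (2 * \<i>))"
      by (intro Bochner_Integration.integral_cong refl) (simp only: left_diff_distrib[symmetric] complex_diff_cnj, simp add: algebra_simps)
    also have "\<dots> = (a - cnj a) / (2 * \<i>) * (CLINT \<omega>|M. iexp (s * X \<omega>))"
      by (simp only: integral_divide_zero Bochner_Integration.integral_diff[OF intZX intZX'] char_eq conj)
         (simp add: algebra_simps diff_divide_distrib)
    also have "(a - cnj a) / (2 * \<i>) = complex_of_real (Im a)" by (simp only: complex_diff_cnj) (simp add: complex_eq_iff)
    finally show "(CLINT \<omega>|M. complex_of_real (Im (Z \<omega>)) * iexp (s * X \<omega>)) =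
       complex_of_real (Im a) * (CLINT \<omega>|M. iexp (s * X \<omega>))" .
  next
    show "\<bar>Im (Z \<omega>)\<bar> \<le> C" if "\<omega> \<in> space M" for \<omega>
      using bound[OF that] abs_Im_le_cmod[of "Z \<omega>"] by linarith
  qed auto
  have intZB: "integrable M (\<lambda>\<omega>. Z \<omega> * indicator B (X \<omega>))"
    by (rule integrable_const_bound[where B=C]) (use bound C0 in \<open>auto simp: indicator_def\<close>)
  show ?thesis
  proof (rule complex_eqI)
    have "Re (CLINT \<omega>|M. Z \<omega> * indicator B (X \<omega>)) = expectation (\<lambda>\<omega>. Re (Z \<omega> * indicator B (X \<omega>)))"
      by (rule integral_Re[OF intZB, symmetric])
    also have "\<dots> = expectation (\<lambda>\<omega>. Re (Z \<omega>) * indicator B (X \<omega>))"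
      by (intro Bochner_Integration.integral_cong) (auto simp: indicator_def)
    finally show "Re (CLINT \<omega>|M. Z \<omega> * indicator B (X \<omega>)) = Re (a * complex_of_real (prob (X -` B \<inter> space M)))"
      by (simp add: re)
    have "Im (CLINT \<omega>|M. Z \<omega> * indicator B (X \<omega>)) = expectation (\<lambda>\<omega>. Im (Z \<omega> * indicator B (X \<omega>)))"
      by (rule integral_Im[OF intZB, symmetric])
    also have "\<dots> = expectation (\<lambda>\<omega>. Im (Z \<omega>) * indicator B (X \<omega>))"
      by (intro Bochner_Integration.integral_cong) (auto simp: indicator_def)
    finally show "Im (CLINT \<omega>|M. Z \<omega> * indicator B (X \<omega>)) = Im (a * complex_of_real (prob (X -` B \<inter> space M)))"
      by (simp add: im)
  qed
qed

text \<open>The factors \<open>exp(i t\<^sub>j X\<^sub>j)\<close> are replaced by indicators of \<open>X\<^sub>j \<in> B\<^sub>j\<close> one index at a time.\<close>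

lemma (in prob_space) indep_vars_if_char_prod:
  fixes X :: "'i \<Rightarrow> 'a \<Rightarrow> real"
  assumes I: "finite I" and X: "\<And>i. i \<in> I \<Longrightarrow> X i \<in> borel_measurable M"
    and char_prod: "\<And>t. (CLINT \<omega>|M. iexp (\<Sum>i\<in>I. t i * X i \<omega>)) = (\<Prod>i\<in>I. CLINT \<omega>|M. iexp (t i * X i \<omega>))"
  shows "indep_vars (\<lambda>_. borel) X I"
proof -
  note X[measurable]
  have main: "(CLINT \<omega>|M. (\<Prod>j\<in>J. indicator (B j) (X j \<omega>)) * iexp (\<Sum>i\<in>I - J. t i * X i \<omega>)) =
      (\<Prod>j\<in>J. complex_of_real (prob (X j -` B j \<inter> space M))) * (\<Prod>i\<in>I - J. CLINT \<omega>|M. iexp (t i * X i \<omega>))"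
    if "J \<subseteq> I" and B: "\<And>j. j \<in> J \<Longrightarrow> B j \<in> sets borel" for J B t
    using finite_subset[OF \<open>J \<subseteq> I\<close> I] that
  proof (induction J arbitrary: t rule: finite_induct)
    case empty
    then show ?case using char_prod[of t] by simp
  next
    case (insert j J)
    let ?K = "I - insert j J"
    have jI: "j \<in> I" and JI: "J \<subseteq> I" using insert by auto
    have [measurable]: "X j \<in> borel_measurable M" using X jI by auto
    have finK: "finite ?K" using I by auto
    have IJ: "I - J = insert j ?K" using insert by auto
    have [measurable]: "i \<in> J \<Longrightarrow> X i \<in> borel_measurable M" "i \<in> ?K \<Longrightarrow> X i \<in> borel_measurable M"
      "i \<in> J \<Longrightarrow> B i \<in> sets borel" "B j \<in> sets borel" for i
      using JI X insert by auto
    \<comment> \<open>\<open>Z\<close> freezes every factor except the one at \<open>j\<close>.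
      Varying only the frequency at \<open>j\<close>, the induction hypothesis at
      \<open>t(j := s)\<close> yields the factorisation required of a weight; this is why
      \<open>t\<close> stays arbitrary in the induction.\<close>
    define Z where "Z \<omega> = (\<Prod>i\<in>J. indicator (B i) (X i \<omega>) :: complex) * iexp (\<Sum>i\<in>?K. t i * X i \<omega>)" for \<omega>
    let ?a = "(\<Prod>i\<in>J. complex_of_real (prob (X i -` B i \<inter> space M))) * (\<Prod>i\<in>?K. CLINT \<omega>|M. iexp (t i * X i \<omega>))"
    have "(CLINT \<omega>|M. Z \<omega> * indicator (B j) (X j \<omega>)) = ?a * complex_of_real (prob (X j -` B j \<inter> space M))"
    proof (rule weighted_char_imp_indep_complex)
      have [measurable]: "(\<lambda>\<omega>. indicator (B i) (X i \<omega>) :: complex) \<in> borel_measurable M" if "i \<in> J" for i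
      proof -
        have [measurable]: "X i \<in> borel_measurable M" "B i \<in> sets borel" using that JI X insert by auto
        show ?thesis by measurable
      qed
      show "Z \<in> borel_measurable M" unfolding Z_def by measurable
      show "norm (Z \<omega>) \<le> 1" for \<omega>
        unfolding Z_def by (auto simp: norm_mult prod_norm[symmetric] indicator_def intro!: prod_le_1)
      fix s
      have "(CLINT \<omega>|M. Z \<omega> * iexp (s * X j \<omega>)) =
        (CLINT \<omega>|M. (\<Prod>i\<in>J. indicator (B i) (X i \<omega>)) * iexp (\<Sum>i\<in>I - J. (t(j := s)) i * X i \<omega>))"
      proof (intro Bochner_Integration.integral_cong refl)
        fix \<omega>
        have "(\<Sum>i\<in>I - J. (t(j := s)) i * X i \<omega>) = s * X j \<omega> + (\<Sum>i\<in>?K. (t(j := s)) i * X i \<omega>)"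
          unfolding IJ using finK by simp
        also have "(\<Sum>i\<in>?K. (t(j := s)) i * X i \<omega>) = (\<Sum>i\<in>?K. t i * X i \<omega>)"
          by (intro sum.cong) auto
        finally have "(\<Sum>i\<in>I - J. (t(j := s)) i * X i \<omega>) = s * X j \<omega> + (\<Sum>i\<in>?K. t i * X i \<omega>)" .
        then show "Z \<omega> * iexp (s * X j \<omega>) =
          (\<Prod>i\<in>J. indicator (B i) (X i \<omega>)) * iexp (\<Sum>i\<in>I - J. (t(j := s)) i * X i \<omega>)"
          by (simp add: Z_def distrib_left exp_add mult_ac)
      qed
      also have "\<dots> = (\<Prod>i\<in>J. complex_of_real (prob (X i -` B i \<inter> space M))) *
         (\<Prod>i\<in>I - J. CLINT \<omega>|M. iexp ((t(j := s)) i * X i \<omega>))"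
        by (rule insert.IH) (use insert in auto)
      also have "(\<Prod>i\<in>I - J. CLINT \<omega>|M. iexp ((t(j := s)) i * X i \<omega>)) =
        (CLINT \<omega>|M. iexp (s * X j \<omega>)) * (\<Prod>i\<in>?K. CLINT \<omega>|M. iexp ((t(j := s)) i * X i \<omega>))"
        unfolding IJ using finK by simp
      also have "(\<Prod>i\<in>?K. CLINT \<omega>|M. iexp ((t(j := s)) i * X i \<omega>)) = (\<Prod>i\<in>?K. CLINT \<omega>|M. iexp (t i * X i \<omega>))"
        by (intro prod.cong) auto
      finally show "(CLINT \<omega>|M. Z \<omega> * iexp (s * X j \<omega>)) = ?a * (CLINT \<omega>|M. iexp (s * X j \<omega>))"
        by (simp add: mult_ac)
    qed auto
    moreover have "(CLINT \<omega>|M. (\<Prod>i\<in>insert j J. indicator (B i) (X i \<omega>)) * iexp (\<Sum>i\<in>?K. t i * X i \<omega>)) =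
       (CLINT \<omega>|M. Z \<omega> * indicator (B j) (X j \<omega>))"
      using insert by (intro Bochner_Integration.integral_cong) (auto simp: Z_def mult_ac)
    ultimately show ?case using insert by (simp add: mult_ac)
  qed
  have prob_eq: "prob (\<Inter>j\<in>J. X j -` B j \<inter> space M) = (\<Prod>j\<in>J. prob (X j -` B j \<inter> space M))"
    if J: "J \<noteq> {}" "J \<subseteq> I" and B: "\<And>j. j \<in> J \<Longrightarrow> B j \<in> sets borel" for J B
  proof -
    have fJ: "finite J" using J I finite_subset by blast
    have E: "(\<Inter>j\<in>J. X j -` B j \<inter> space M) \<in> events"
      using J B X fJ by (intro sets.finite_INT) auto
    have ind: "(\<Prod>j\<in>J. indicator (B j) (X j \<omega>)) = complex_of_real (indicator (\<Inter>j\<in>J. X j -` B j \<inter> space M) \<omega>)"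
      if "\<omega> \<in> space M" for \<omega>
      using fJ J that by (auto simp: indicator_def intro!: prod.neutral)
    \<comment> \<open>Indices outside \<open>J\<close> receive frequency zero, so their exponentials
      become 1 on both sides.\<close>
    have "complex_of_real (prob (\<Inter>j\<in>J. X j -` B j \<inter> space M)) =
      (CLINT \<omega>|M. complex_of_real (indicator (\<Inter>j\<in>J. X j -` B j \<inter> space M) \<omega>))"
      using E by simp
    also have "\<dots> = (CLINT \<omega>|M. (\<Prod>j\<in>J. indicator (B j) (X j \<omega>)) * iexp (\<Sum>i\<in>I - J. 0 * X i \<omega>))"
      by (intro Bochner_Integration.integral_cong) (auto simp: ind)
    also have "\<dots> = (\<Prod>j\<in>J. complex_of_real (prob (X j -` B j \<inter> space M))) * (\<Prod>i\<in>I - J. CLINT \<omega>|M. iexp (0 * X i \<omega>))"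
      by (rule main[of J B "\<lambda>_. 0"]) (use J B in auto)
    finally show ?thesis
      by (simp add: prob_space flip: of_real_prod)
  qed
  show ?thesis
    unfolding indep_vars_def2
  proof (intro conjI ballI indep_setsI)
    fix A J assume J: "J \<noteq> {}" "J \<subseteq> I" "finite J"
      and A: "\<forall>j\<in>J. A j \<in> {X j -` S \<inter> space M |S. S \<in> sets borel}"
    then obtain B where B: "\<And>j. j \<in> J \<Longrightarrow> A j = X j -` B j \<inter> space M \<and> B j \<in> sets borel"
      by simp metis
    then show "prob (\<Inter>j\<in>J. A j) = (\<Prod>j\<in>J. prob (A j))"
      using prob_eq[OF J(1,2), of B] by auto
  qed (use X in auto)
qed

text \<open>A nondegenerate variable is rescaled to a standard normal one. The degenerate case obeys
  the same formula with second moment zero, so later arguments need not separate the two.\<close>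

lemma (in prob_space) centered_gaussian_char:
  assumes "centered_gaussian M X"
  shows "X \<in> borel_measurable M" "integrable M (\<lambda>\<omega>. (X \<omega>)\<^sup>2)"
    "(CLINT \<omega>|M. iexp (X \<omega>)) = complex_of_real (exp (- expectation (\<lambda>\<omega>. (X \<omega>)\<^sup>2) / 2))"
proof -
  show X[measurable]: "X \<in> borel_measurable M"
    using assms by (simp add: centered_gaussian_def)
  have "integrable M (\<lambda>\<omega>. (X \<omega>)\<^sup>2) \<and>
    (CLINT \<omega>|M. iexp (X \<omega>)) = complex_of_real (exp (- expectation (\<lambda>\<omega>. (X \<omega>)\<^sup>2) / 2))"
    using assms unfolding centered_gaussian_def
  proof (elim conjE disjE exE)
    assume 0: "AE \<omega> in M. X \<omega> = 0"
    have "integrable M (\<lambda>\<omega>. (X \<omega>)\<^sup>2) \<longleftrightarrow> integrable M (\<lambda>\<omega>. 0 :: real)"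
      by (rule integrable_cong_AE) (use 0 in auto)
    moreover have "expectation (\<lambda>\<omega>. (X \<omega>)\<^sup>2) = expectation (\<lambda>\<omega>. 0)"
      by (rule integral_cong_AE) (use 0 in auto)
    moreover have "(CLINT \<omega>|M. iexp (X \<omega>)) = (CLINT \<omega>|M. 1)"
      by (rule integral_cong_AE) (use 0 in auto)
    ultimately show ?thesis by (simp add: prob_space)
  next
    fix s assume s: "0 < s" and D: "distributed M lborel X (\<lambda>x. ennreal (normal_density 0 s x))"
    have "integrable lborel (\<lambda>x. normal_density 0 s x * x\<^sup>2)"
      using integrable_normal_moment[OF s, of 0 2] by simp
    then have int: "integrable M (\<lambda>\<omega>. (X \<omega>)\<^sup>2)"
      by (subst distributed_integrable[OF D, symmetric]) auto
    have EX2: "expectation (\<lambda>\<omega>. (X \<omega>)\<^sup>2) = s\<^sup>2"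
      using normal_distributed_variance[OF s D] normal_distributed_expectation[OF s D] by simp
    define Y where "Y \<omega> = X \<omega> / s" for \<omega>
    have [measurable]: "Y \<in> borel_measurable M" unfolding Y_def by measurable
    have "distributed M lborel Y std_normal_density"
      using D normal_standard_normal_convert[OF s, of X 0] by (simp add: Y_def[abs_def])
    then have distrY: "distr M borel Y = std_normal_distribution"
      by (simp add: distributed_def cong: distr_cong)
    have "(CLINT \<omega>|M. iexp (X \<omega>)) = (CLINT \<omega>|M. iexp (s * Y \<omega>))"
      using s by (simp add: Y_def)
    also have "\<dots> = char (distr M borel Y) s"
      unfolding char_def by (subst integral_distr) auto
    also have "\<dots> = complex_of_real (exp (- s\<^sup>2 / 2))"
      by (simp only: distrY char_std_normal_distribution)
    finally show ?thesis using int EX2 by simp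
  qed
  then show "integrable M (\<lambda>\<omega>. (X \<omega>)\<^sup>2)"
    "(CLINT \<omega>|M. iexp (X \<omega>)) = complex_of_real (exp (- expectation (\<lambda>\<omega>. (X \<omega>)\<^sup>2) / 2))" by auto
qed

lemma integrable_mult_of_squares:
  fixes X Y :: "'a \<Rightarrow> real"
  assumes [measurable]: "X \<in> borel_measurable M" "Y \<in> borel_measurable M"
    and "integrable M (\<lambda>\<omega>. (X \<omega>)\<^sup>2)" "integrable M (\<lambda>\<omega>. (Y \<omega>)\<^sup>2)"
  shows "integrable M (\<lambda>\<omega>. X \<omega> * Y \<omega>)"
proof (rule Bochner_Integration.integrable_bound)
  show "integrable M (\<lambda>\<omega>. (X \<omega>)\<^sup>2 + (Y \<omega>)\<^sup>2)" using assms by simp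
  have "\<bar>a * b\<bar> \<le> a\<^sup>2 + b\<^sup>2" for a b :: real
    using sum_squares_bound[of "\<bar>a\<bar>" "\<bar>b\<bar>"] mult_nonneg_nonneg[of "\<bar>a\<bar>" "\<bar>b\<bar>"] unfolding abs_mult by (simp only: power2_abs) linarith
  then show "AE \<omega> in M. norm (X \<omega> * Y \<omega>) \<le> norm ((X \<omega>)\<^sup>2 + (Y \<omega>)\<^sup>2)"
    by (intro AE_I2) (simp add: order_trans[OF _ abs_ge_self])
qed simp

text \<open>Once the cross terms vanish, the second moment of a linear combination is the sum of
  those of its terms, and the exponential turns this sum into the product of the characteristic
  functions. Joint Gaussianity enters through \<open>gauss\<close> holding for every coefficient
  family.\<close>

lemma (in prob_space) uncorrelated_gaussian_imp_indep:
  fixes X :: "'i \<Rightarrow> 'a \<Rightarrow> real"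
  assumes I: "finite I"
    and gauss: "\<And>t. centered_gaussian M (\<lambda>\<omega>. \<Sum>i\<in>I. t i * X i \<omega>)"
    and uncor: "\<And>i j. i \<in> I \<Longrightarrow> j \<in> I \<Longrightarrow> i \<noteq> j \<Longrightarrow> expectation (\<lambda>\<omega>. X i \<omega> * X j \<omega>) = 0"
  shows "indep_vars (\<lambda>_. borel) X I"
proof (rule indep_vars_if_char_prod[OF I])
  have gauss1: "centered_gaussian M (\<lambda>\<omega>. c * X i \<omega>)" if "i \<in> I" for i c
  proof -
    have "(\<lambda>\<omega>. \<Sum>j\<in>I. (if j = i then c else 0) * X j \<omega>) = (\<lambda>\<omega>. c * X i \<omega>)"
      using I that by (simp add: if_distrib[of "\<lambda>x. x * _"] cong: if_cong)
    then show ?thesis using gauss[of "\<lambda>j. if j = i then c else 0"] by simp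
  qed
  show X: "X i \<in> borel_measurable M" if "i \<in> I" for i
    using centered_gaussian_char(1)[OF gauss1[OF that, of 1]] by simp
  have sq: "integrable M (\<lambda>\<omega>. (X i \<omega>)\<^sup>2)" if "i \<in> I" for i
    using centered_gaussian_char(2)[OF gauss1[OF that, of 1]] by simp
  have int: "integrable M (\<lambda>\<omega>. X i \<omega> * X j \<omega>)" if "i \<in> I" "j \<in> I" for i j
    by (rule integrable_mult_of_squares) (use X sq that in auto)
  fix t
  have "expectation (\<lambda>\<omega>. (\<Sum>i\<in>I. t i * X i \<omega>)\<^sup>2) = expectation (\<lambda>\<omega>. \<Sum>i\<in>I. \<Sum>j\<in>I. t i * t j * (X i \<omega> * X j \<omega>))"
    by (intro Bochner_Integration.integral_cong refl) (simp add: power2_eq_square sum_product mult_ac)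
  also have "\<dots> = (\<Sum>i\<in>I. \<Sum>j\<in>I. t i * t j * expectation (\<lambda>\<omega>. X i \<omega> * X j \<omega>))"
    using int by (simp add: Bochner_Integration.integral_sum)
  also have "\<dots> = (\<Sum>i\<in>I. \<Sum>j\<in>I. if i = j then t i * t j * expectation (\<lambda>\<omega>. X i \<omega> * X j \<omega>) else 0)"
    by (intro sum.cong refl) (auto simp: uncor)
  also have "\<dots> = (\<Sum>i\<in>I. expectation (\<lambda>\<omega>. (t i * X i \<omega>)\<^sup>2))"
    using I by (simp add: power2_eq_square mult_ac)
  finally have "(CLINT \<omega>|M. iexp (\<Sum>i\<in>I. t i * X i \<omega>)) =
      complex_of_real (exp (\<Sum>i\<in>I. - expectation (\<lambda>\<omega>. (t i * X i \<omega>)\<^sup>2) / 2))"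
    unfolding centered_gaussian_char(3)[OF gauss] by (simp add: sum_negf sum_divide_distrib)
  also have "\<dots> = (\<Prod>i\<in>I. complex_of_real (exp (- expectation (\<lambda>\<omega>. (t i * X i \<omega>)\<^sup>2) / 2)))"
    unfolding exp_sum[OF I] by simp
  also have "\<dots> = (\<Prod>i\<in>I. CLINT \<omega>|M. iexp (t i * X i \<omega>))"
    by (intro prod.cong refl) (simp only: centered_gaussian_char(3)[OF gauss1])
  finally show "(CLINT \<omega>|M. iexp (\<Sum>i\<in>I. t i * X i \<omega>)) = (\<Prod>i\<in>I. CLINT \<omega>|M. iexp (t i * X i \<omega>))" .
qed

section \<open>Absolutely continuous noise\<close>

text \<open>It suffices to compare the two measures on boxes. There the indicator factorises like
  the density, and Tonelli splits the integral.\<close>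

lemma PiM_density:
  assumes "product_sigma_finite M" "\<And>i. sigma_finite_measure (density (M i) (f i))"
    and I: "finite I" and f: "\<And>i. i \<in> I \<Longrightarrow> f i \<in> borel_measurable (M i)"
  shows "PiM I (\<lambda>i. density (M i) (f i)) = density (PiM I M) (\<lambda>x. \<Prod>i\<in>I. f i (x i))"
proof -
  interpret M: product_sigma_finite M by fact
  interpret D: product_sigma_finite "\<lambda>i. density (M i) (f i)"
    using assms(2) by (simp add: product_sigma_finite_def)
  note f[measurable]
  show ?thesis
  proof (rule D.PiM_eqI[OF I, symmetric])
    show "sets (density (PiM I M) (\<lambda>x. \<Prod>i\<in>I. f i (x i))) = sets (PiM I (\<lambda>i. density (M i) (f i)))"
      by (simp cong: sets_PiM_cong)
    fix A assume "\<And>i. i \<in> I \<Longrightarrow> A i \<in> sets (density (M i) (f i))"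
    then have A[measurable]: "\<And>i. i \<in> I \<Longrightarrow> A i \<in> sets (M i)" by simp
    have m: "(\<lambda>x. \<Prod>i\<in>I. f i (x i)) \<in> borel_measurable (PiM I M)"
      by (intro borel_measurable_prod_ennreal, rule measurable_compose[where g="f i" and N="M i" for i]) (use f in auto)
    have ind: "indicator (Pi\<^sub>E I A) x = (\<Prod>i\<in>I. indicator (A i) (x i) :: ennreal)" if "x \<in> space (PiM I M)" for x
      using that I by (auto simp: indicator_def space_PiM PiE_iff extensional_def prod_zero_iff)
    have "emeasure (density (PiM I M) (\<lambda>x. \<Prod>i\<in>I. f i (x i))) (Pi\<^sub>E I A) =
      (\<integral>\<^sup>+x. (\<Prod>i\<in>I. f i (x i)) * indicator (Pi\<^sub>E I A) x \<partial>PiM I M)"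
      using A I m by (intro emeasure_density sets_PiM_I_finite) auto
    also have "\<dots> = (\<integral>\<^sup>+x. (\<Prod>i\<in>I. f i (x i) * indicator (A i) (x i)) \<partial>PiM I M)"
      by (intro nn_integral_cong) (simp add: ind prod.distrib)
    also have "\<dots> = (\<Prod>i\<in>I. \<integral>\<^sup>+x. f i x * indicator (A i) x \<partial>M i)"
      by (rule M.product_nn_integral_prod[OF I]) auto
    also have "\<dots> = (\<Prod>i\<in>I. emeasure (density (M i) (f i)) (A i))"
      by (intro prod.cong refl) (simp add: emeasure_density)
    finally show "emeasure (density (PiM I M) (\<lambda>x. \<Prod>i\<in>I. f i (x i))) (Pi\<^sub>E I A) =
      (\<Prod>i\<in>I. emeasure (density (M i) (f i)) (A i))" .
  qed
qed

text \<open>Independence makes the law of the coordinate family a product, which has a density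
  against the product of one-dimensional Lebesgue measures. Since \<open>lborel\<close> is the image
  of that product under the map from coordinates to vectors, null sets can be pulled back along this
  map.\<close>

lemma (in prob_space) indep_components_absolutely_continuous:
  fixes D :: "'a \<Rightarrow> 'b::euclidean_space"
  assumes D[measurable]: "D \<in> borel_measurable M"
    and indep: "indep_vars (\<lambda>_. borel) (\<lambda>b \<omega>. D \<omega> \<bullet> b) Basis"
    and dens: "\<And>b. b \<in> Basis \<Longrightarrow> \<exists>f. distributed M lborel (\<lambda>\<omega>. D \<omega> \<bullet> b) f"
  shows "absolutely_continuous lborel (distr M borel D)"
proof -
  obtain f0 where f0: "\<And>b. b \<in> Basis \<Longrightarrow> distributed M lborel (\<lambda>\<omega>. D \<omega> \<bullet> b) (f0 b)"
    using dens by metis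
  \<comment> \<open>Off \<open>Basis\<close> any probability density would do; one is required
    because the product lemma asks for sigma-finiteness at every index of the type.\<close>
  define f where "f b = (if b \<in> Basis then f0 b else std_normal_density)" for b
  have f_m: "f b \<in> borel_measurable lborel" for b
    using f0[of b] by (auto simp: f_def distributed_def)
  have f_eq: "distr M borel (\<lambda>\<omega>. D \<omega> \<bullet> b) = density lborel (f b)" if "b \<in> Basis" for b
  proof -
    have "distr M borel (\<lambda>\<omega>. D \<omega> \<bullet> b) = distr M lborel (\<lambda>\<omega>. D \<omega> \<bullet> b)" by (rule distr_cong) auto
    then show ?thesis using f0[OF that] that by (simp add: f_def distributed_def)
  qed
  have f_prob: "prob_space (density lborel (f b))" for b
  proof (cases "b \<in> Basis")
    case True
    then show ?thesis unfolding f_eq[OF True, symmetric] by (intro prob_space_distr) auto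
  qed (simp add: f_def prob_space_normal_density)
  have "distr M (PiM Basis (\<lambda>_. borel)) (\<lambda>\<omega>. \<lambda>b\<in>Basis. D \<omega> \<bullet> b) = PiM Basis (\<lambda>b. distr M borel (\<lambda>\<omega>. D \<omega> \<bullet> b))"
    using indep by (subst (asm) indep_vars_iff_distr_eq_PiM) auto
  also have "\<dots> = PiM Basis (\<lambda>b. density lborel (f b))"
    by (intro PiM_cong refl f_eq)
  also have "\<dots> = density (PiM Basis (\<lambda>_. lborel)) (\<lambda>x. \<Prod>b\<in>Basis. f b (x b))"
    by (rule PiM_density) (use f_m f_prob in \<open>auto simp: product_sigma_finite_def sigma_finite_lborel
      intro: prob_space_imp_sigma_finite\<close>)
  finally have joint: "distr M (PiM Basis (\<lambda>_. borel)) (\<lambda>\<omega>. \<lambda>b\<in>Basis. D \<omega> \<bullet> b) =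
    density (PiM Basis (\<lambda>_. lborel)) (\<lambda>x. \<Prod>b\<in>Basis. f b (x b))" .
  let ?S = "\<lambda>x. \<Sum>b\<in>Basis. x b *\<^sub>R b :: 'b"
  have S[measurable]: "?S \<in> measurable (PiM Basis (\<lambda>_. borel)) borel" by measurable
  have m: "(\<lambda>x. \<Prod>b\<in>Basis. f b (x b)) \<in> borel_measurable (PiM Basis (\<lambda>_. lborel))"
    by (intro borel_measurable_prod_ennreal, rule measurable_compose[where g="f b" and N=lborel for b]) (use f_m in auto)
  show ?thesis
    unfolding absolutely_continuous_def
  proof
    fix N :: "'b set" assume N: "N \<in> null_sets lborel"
    then have [measurable]: "N \<in> sets borel" by auto
    let ?N = "?S -` N \<inter> space (PiM Basis (\<lambda>_. borel :: real measure))"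
    have N': "?N \<in> sets (PiM Basis (\<lambda>_. borel :: real measure))" by measurable
    have sp: "space (PiM Basis (\<lambda>_. borel :: real measure)) = space (PiM (Basis :: 'b set) (\<lambda>_. lborel :: real measure))"
      "sets (PiM Basis (\<lambda>_. borel :: real measure)) = sets (PiM (Basis :: 'b set) (\<lambda>_. lborel :: real measure))"
      by (auto simp: space_PiM cong: sets_PiM_cong)
    have "0 = emeasure (distr (PiM Basis (\<lambda>_. lborel)) borel ?S) N"
      using N unfolding lborel_eq[where 'a='b] by auto
    also have "\<dots> = emeasure (PiM Basis (\<lambda>_. lborel)) ?N"
      unfolding sp by (intro emeasure_distr) auto
    finally have "?N \<in> null_sets (PiM Basis (\<lambda>_. lborel))"
      using N' by (auto simp: null_sets_def sp)
    then have "?N \<in> null_sets (density (PiM Basis (\<lambda>_. lborel)) (\<lambda>x. \<Prod>b\<in>Basis. f b (x b)))"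
      using absolutely_continuousI_density[OF m] by (auto simp: absolutely_continuous_def)
    then have "emeasure (distr M (PiM Basis (\<lambda>_. borel)) (\<lambda>\<omega>. \<lambda>b\<in>Basis. D \<omega> \<bullet> b)) ?N = 0"
      unfolding joint by auto
    also have "emeasure (distr M (PiM Basis (\<lambda>_. borel)) (\<lambda>\<omega>. \<lambda>b\<in>Basis. D \<omega> \<bullet> b)) ?N =
      emeasure M ((\<lambda>\<omega>. \<lambda>b\<in>Basis. D \<omega> \<bullet> b) -` ?N \<inter> space M)"
      by (rule emeasure_distr) (use N' in auto)
    also have "(\<lambda>\<omega>. \<lambda>b\<in>Basis. D \<omega> \<bullet> b) -` ?N \<inter> space M = D -` N \<inter> space M"
      by (auto simp: space_PiM euclidean_representation cong: sum.cong)
    also have "emeasure M \<dots> = emeasure (distr M borel D) N"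
      by (simp add: emeasure_distr)
    finally show "N \<in> null_sets (distr M borel D)" by (auto simp: null_sets_def)
  qed
qed

text \<open>Connects the Borel measure in which absolute continuity is stated with
  \<open>negligible\<close>, the notion used for images under differentiable maps.\<close>

lemma null_sets_lborel_iff_negligible:
  "N \<in> sets borel \<Longrightarrow> N \<in> null_sets lborel \<longleftrightarrow> negligible N"
  by (simp add: negligible_iff_null_sets null_sets_completion_iff)

text \<open>The joint law of \<open>V\<close> and \<open>D\<close> is a product, so by Fubini the
  value \<open>v\<close> of \<open>V\<close> may be fixed. The bad values of \<open>D\<close> are
  then the image of a translate of \<open>N\<close> under the inverse of \<open>L v\<close>, hence a
  null set for every \<open>v\<close>. The law of \<open>V\<close> may be a point mass, as happens
  in the first time step.\<close>

lemma (in prob_space) state_dependent_noise_avoids_null_set: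
  fixes V D :: "'a \<Rightarrow> 'b::euclidean_space"
  assumes indep: "indep_var borel V borel D"
    and ac: "absolutely_continuous lborel (distr M borel D)"
    and lin: "\<And>v. linear (L v)" and inj: "\<And>v. inj (L v)"
    and L[measurable]: "(\<lambda>(v, d). L v d) \<in> borel_measurable (borel \<Otimes>\<^sub>M borel)"
    and N: "N \<in> null_sets lborel"
  shows "AE \<omega> in M. V \<omega> + L (V \<omega>) (D \<omega>) \<notin> N"
proof -
  have Nb[measurable]: "N \<in> sets borel" using N by auto
  have [measurable]: "V \<in> borel_measurable M" "D \<in> borel_measurable M"
    using indep by (auto dest: indep_var_rv1 indep_var_rv2)
  define Q where "Q = {p \<in> space (borel \<Otimes>\<^sub>M borel). fst p + (case p of (v, d) \<Rightarrow> L v d) \<in> N}"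
  have Q[measurable]: "Q \<in> sets (borel \<Otimes>\<^sub>M borel)" unfolding Q_def by measurable
  interpret DD: prob_space "distr M borel D" by (rule prob_space_distr) simp
  have sect: "emeasure (distr M borel D) (Pair v -` Q) = 0" for v
  proof -
    obtain h where h: "linear h" "\<And>x. h (L v x) = x" "\<And>x. L v (h x) = x"
      using linear_injective_isomorphism[OF lin inj] by metis
    have "Pair v -` Q = h ` ((\<lambda>x. - v + x) ` N)"
    proof (intro set_eqI iffI)
      fix d assume "d \<in> Pair v -` Q"
      then have "v + L v d \<in> N" by (simp add: Q_def)
      then show "d \<in> h ` ((\<lambda>x. - v + x) ` N)"
        by (intro image_eqI[where x="L v d"] image_eqI[where x="v + L v d"]) (auto simp: h)
    qed (auto simp: Q_def space_pair_measure h)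
    moreover have "negligible N" using N null_sets_lborel_iff_negligible[OF Nb] by simp
    ultimately have "negligible (Pair v -` Q)"
      by (simp only:) (intro negligible_differentiable_image_negligible order_refl
        linear_imp_differentiable_on[OF h(1)] negligible_translation)
    moreover have "Pair v -` Q \<in> sets borel" by (rule sets_Pair1[OF Q])
    ultimately have "Pair v -` Q \<in> null_sets lborel" by (simp add: null_sets_lborel_iff_negligible)
    then show ?thesis using ac by (auto simp: absolutely_continuous_def)
  qed
  have "emeasure (distr M (borel \<Otimes>\<^sub>M borel) (\<lambda>\<omega>. (V \<omega>, D \<omega>))) Q =
    emeasure (distr M borel V \<Otimes>\<^sub>M distr M borel D) Q"
    using indep by (simp add: indep_var_distribution_eq)
  also have "\<dots> = 0"
    using Q by (subst DD.emeasure_pair_measure_alt) (auto simp: sect cong: sets_pair_measure_cong)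
  finally have "emeasure M ((\<lambda>\<omega>. (V \<omega>, D \<omega>)) -` Q \<inter> space M) = 0"
    by (subst (asm) emeasure_distr) auto
  then show ?thesis
    by (intro AE_I'[where N="(\<lambda>\<omega>. (V \<omega>, D \<omega>)) -` Q \<inter> space M"])
       (auto simp: null_sets_def Q_def space_pair_measure)
qed

section \<open>Increments of the Brownian sheet\<close>

lemma inj_pos: "inj (pos :: 'd::{finite,linorder} \<Rightarrow> nat)"
proof -
  have "pos j < pos k" if "j < k" for j k :: 'd
  proof -
    have "k \<in> {i. i \<le> k}" "k \<notin> {i. i \<le> j}" using that by auto
    then have "{i. i \<le> j} \<subset> {i. i \<le> k}" using that by auto
    then show ?thesis unfolding pos_def by (intro psubset_card_mono) auto
  qed
  then have "strict_mono (pos :: 'd \<Rightarrow> nat)" by (rule strict_monoI)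
  then show ?thesis by (rule strict_mono_imp_inj_on)
qed

lemma range_pos: "range (pos :: 'd::{finite,linorder} \<Rightarrow> nat) = {1..CARD('d)}"
proof (rule card_subset_eq)
  show "range (pos :: 'd \<Rightarrow> nat) \<subseteq> {1..CARD('d)}"
    by (auto simp: pos_def Suc_le_eq card_gt_0_iff intro!: card_mono)
  show "card (range (pos :: 'd \<Rightarrow> nat)) = card {1..CARD('d)}"
    by (simp add: card_image inj_pos)
qed simp

lemma pos_bounds: "1 \<le> pos (k :: 'd::{finite,linorder}) \<and> pos k \<le> CARD('d)"
  using range_pos[where 'd='d] by auto

lemma sum_over_pos: "(\<Sum>k\<in>UNIV. g (pos (k :: 'd::{finite,linorder}))) = (\<Sum>j=1..CARD('d). g j)"
  using sum.reindex[OF inj_pos[where 'd='d], of g] unfolding range_pos by simp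

section \<open>Finite linear combinations of sheet values\<close>

definition sheet_span :: "(real \<Rightarrow> real \<Rightarrow> 'a \<Rightarrow> real) \<Rightarrow> (real \<times> real) set \<Rightarrow> ('a \<Rightarrow> real) set" where
  "sheet_span W S = {Y. \<exists>P c. finite P \<and> P \<subseteq> S \<and> Y = (\<lambda>\<omega>. \<Sum>p\<in>P. c p * W (fst p) (snd p) \<omega>)}"

lemma sheet_span_base: "(t, x) \<in> S \<Longrightarrow> W t x \<in> sheet_span W S"
  unfolding sheet_span_def
  by (intro CollectI exI[of _ "{(t, x)}"] exI[of _ "\<lambda>_. 1"]) auto

lemma sheet_span_scale:
  assumes "Y \<in> sheet_span W S"
  shows "(\<lambda>\<omega>. a * Y \<omega>) \<in> sheet_span W S"
proof -
  obtain P c where "finite P" "P \<subseteq> S" "Y = (\<lambda>\<omega>. \<Sum>p\<in>P. c p * W (fst p) (snd p) \<omega>)"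
    using assms unfolding sheet_span_def by blast
  then show ?thesis
    unfolding sheet_span_def
    by (intro CollectI exI[of _ P] exI[of _ "\<lambda>p. a * c p"]) (auto simp: sum_distrib_left mult_ac)
qed

lemma sheet_span_add:
  assumes "Y \<in> sheet_span W S" "Z \<in> sheet_span W S"
  shows "(\<lambda>\<omega>. Y \<omega> + Z \<omega>) \<in> sheet_span W S"
proof -
  obtain P c where P: "finite P" "P \<subseteq> S" "Y = (\<lambda>\<omega>. \<Sum>p\<in>P. c p * W (fst p) (snd p) \<omega>)"
    using assms(1) unfolding sheet_span_def by blast
  obtain Q d where Q: "finite Q" "Q \<subseteq> S" "Z = (\<lambda>\<omega>. \<Sum>p\<in>Q. d p * W (fst p) (snd p) \<omega>)"
    using assms(2) unfolding sheet_span_def by blast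
  \<comment> \<open>The two point sets may overlap, so both coefficient families are extended by
    zero to the union before they are added.\<close>
  have ext: "(\<Sum>p\<in>R. (e p :: real) * W (fst p) (snd p) \<omega>) =
      (\<Sum>p\<in>P \<union> Q. (if p \<in> R then e p else 0) * W (fst p) (snd p) \<omega>)" if "R \<subseteq> P \<union> Q" for R e \<omega>
    using that P(1) Q(1) by (intro sum.mono_neutral_cong_left) auto
  have "Y \<omega> + Z \<omega> = (\<Sum>p\<in>P \<union> Q. ((if p \<in> P then c p else 0) + (if p \<in> Q then d p else 0)) * W (fst p) (snd p) \<omega>)" for \<omega>
    unfolding P(3) Q(3) ext[of P c, OF Un_upper1] ext[of Q d, OF Un_upper2]
    by (simp add: sum.distrib distrib_right)
  then show ?thesis
    unfolding sheet_span_def using P Q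
    by (intro CollectI exI[of _ "P \<union> Q"] exI[of _ "\<lambda>p. (if p \<in> P then c p else 0) + (if p \<in> Q then d p else 0)"])
       auto
qed

lemma sheet_span_sum:
  assumes "finite I" "\<And>i. i \<in> I \<Longrightarrow> Y i \<in> sheet_span W S"
  shows "(\<lambda>\<omega>. \<Sum>i\<in>I. Y i \<omega>) \<in> sheet_span W S"
  using assms
proof (induction I)
  case empty
  show ?case
    unfolding sheet_span_def by (intro CollectI exI[of _ "{}"]) auto
qed (simp add: sheet_span_add)

text \<open>The span has exactly the form of the Gaussian clause of \<open>brownian_sheet\<close>;
  with the closure properties above, Gaussianity can be shown without exhibiting point sets and
  coefficients.\<close>

lemma sheet_span_gaussian:
  assumes "brownian_sheet M T L W" "Y \<in> sheet_span W ({0..T} \<times> {0..L})"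
  shows "centered_gaussian M Y"
  using assms unfolding sheet_span_def brownian_sheet_def by blast

section \<open>Rectangular increments of the sheet and their covariance\<close>

definition sheet_increment ::
  "(real \<Rightarrow> real \<Rightarrow> 'a \<Rightarrow> real) \<Rightarrow> real \<Rightarrow> real \<Rightarrow> real \<Rightarrow> real \<Rightarrow> 'a \<Rightarrow> real" where
  "sheet_increment W s t x y \<omega> = W t y \<omega> - W t x \<omega> - W s y \<omega> + W s x \<omega>"

text \<open>For \<open>s \<le> t\<close> and \<open>s' \<le> t'\<close> this is the length of \<open>[s, t] \<inter> [s', t']\<close>.\<close>

definition overlap :: "real \<Rightarrow> real \<Rightarrow> real \<Rightarrow> real \<Rightarrow> real" where
  "overlap s t s' t' = min t t' - min t s' - min s t' + min s s'"

lemma overlap_self: "s \<le> t \<Longrightarrow> overlap s t s t = t - s"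
  by (simp add: overlap_def)

lemma overlap_disjoint:
  assumes "s \<le> t" "t \<le> s'" "s' \<le> t'"
  shows "overlap s t s' t' = 0" "overlap s' t' s t = 0"
  using assms by (auto simp: overlap_def)

text \<open>Distinct cells of a uniform grid share at most an end point. The fact serves twice, for
  the time steps and for the spatial mesh.\<close>

lemma overlap_grid:
  assumes "a \<ge> 0"
  shows "overlap (real i * a) (real (Suc i) * a) (real j * a) (real (Suc j) * a) = (if i = j then a else 0)"
proof -
  have mono: "real k * a \<le> real l * a" if "k \<le> l" for k l
    using assms that by (intro mult_right_mono) auto
  consider "i = j" | "Suc i \<le> j" | "Suc j \<le> i" by linarith
  then show ?thesis
  proof cases
    case 1
    then show ?thesis using overlap_self[OF mono[of i "Suc i"]] by (simp add: algebra_simps)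
  next
    case 2
    then have "overlap (real i * a) (real (Suc i) * a) (real j * a) (real (Suc j) * a) = 0"
      by (intro overlap_disjoint mono) auto
    then show ?thesis using 2 by simp
  next
    case 3
    then have "overlap (real i * a) (real (Suc i) * a) (real j * a) (real (Suc j) * a) = 0"
      by (intro overlap_disjoint mono) auto
    then show ?thesis using 3 by simp
  qed
qed

lemma sheet_increment_in_span:
  assumes "s \<in> {0..T}" "t \<in> {0..T}" "x \<in> {0..L}" "y \<in> {0..L}"
  shows "sheet_increment W s t x y \<in> sheet_span W ({0..T} \<times> {0..L})"
proof -
  have W: "W t y \<in> sheet_span W ({0..T} \<times> {0..L})" if "t \<in> {0..T}" "y \<in> {0..L}" for t y
    using that by (intro sheet_span_base) auto
  have "(\<lambda>\<omega>. W t y \<omega> + - 1 * W t x \<omega> + - 1 * W s y \<omega> + W s x \<omega>) \<in> sheet_span W ({0..T} \<times> {0..L})"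
    by (intro sheet_span_add sheet_span_scale W assms)
  then show ?thesis by (simp add: sheet_increment_def[abs_def])
qed

text \<open>Each sheet covariance is a time factor times a space factor, so the alternating sum from
  the bilinear expansion factorises as well. The expansion treats one increment at a time:
  \<open>cov'\<close> pairs the first with a single sheet value.\<close>

lemma (in prob_space) sheet_increment_covariance:
  assumes W: "brownian_sheet M T L W"
    and mem: "s \<in> {0..T}" "t \<in> {0..T}" "x \<in> {0..L}" "y \<in> {0..L}"
      "s' \<in> {0..T}" "t' \<in> {0..T}" "x' \<in> {0..L}" "y' \<in> {0..L}"
  shows "expectation (\<lambda>\<omega>. sheet_increment W s t x y \<omega> * sheet_increment W s' t' x' y' \<omega>) =
    overlap s t s' t' * overlap x y x' y'"
proof -
  have gauss: "centered_gaussian M (W t x)" if "t \<in> {0..T}" "x \<in> {0..L}" for t x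
    using that by (intro sheet_span_gaussian[OF W] sheet_span_base) auto
  have cov: "has_bochner_integral M (\<lambda>\<omega>. W t x \<omega> * W t' x' \<omega>) (min t t' * min x x')"
    if "t \<in> {0..T}" "x \<in> {0..L}" "t' \<in> {0..T}" "x' \<in> {0..L}" for t x t' x'
    unfolding has_bochner_integral_iff
    using W that integrable_mult_of_squares[OF centered_gaussian_char(1)[OF gauss] centered_gaussian_char(1)[OF gauss]
      centered_gaussian_char(2)[OF gauss] centered_gaussian_char(2)[OF gauss], of t x t' x']
    by (auto simp: brownian_sheet_def)
  have cov': "has_bochner_integral M (\<lambda>\<omega>. sheet_increment W s t x y \<omega> * W u z \<omega>)
      ((min t u - min s u) * (min y z - min x z))" if "u \<in> {0..T}" "z \<in> {0..L}" for u z
  proof -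
    have "has_bochner_integral M
      (\<lambda>\<omega>. W t y \<omega> * W u z \<omega> - W t x \<omega> * W u z \<omega> - W s y \<omega> * W u z \<omega> + W s x \<omega> * W u z \<omega>)
      (min t u * min y z - min t u * min x z - min s u * min y z + min s u * min x z)"
      using mem that by (intro has_bochner_integral_add has_bochner_integral_diff cov)
    then show ?thesis by (simp add: sheet_increment_def algebra_simps)
  qed
  let ?I = "sheet_increment W s t x y"
  have "has_bochner_integral M
      (\<lambda>\<omega>. ?I \<omega> * W t' y' \<omega> - ?I \<omega> * W t' x' \<omega> - ?I \<omega> * W s' y' \<omega> + ?I \<omega> * W s' x' \<omega>)
      ((min t t' - min s t') * (min y y' - min x y') - (min t t' - min s t') * (min y x' - min x x')
       - (min t s' - min s s') * (min y y' - min x y') + (min t s' - min s s') * (min y x' - min x x'))"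
    using mem by (intro has_bochner_integral_add has_bochner_integral_diff cov')
  moreover have "(\<lambda>\<omega>. ?I \<omega> * W t' y' \<omega> - ?I \<omega> * W t' x' \<omega> - ?I \<omega> * W s' y' \<omega> + ?I \<omega> * W s' x' \<omega>) =
      (\<lambda>\<omega>. ?I \<omega> * sheet_increment W s' t' x' y' \<omega>)"
    unfolding sheet_increment_def[of W s' t' x' y'] by (simp add: algebra_simps)
  ultimately show ?thesis
    by (simp add: has_bochner_integral_iff overlap_def algebra_simps)
qed

text \<open>Up to the factor \<open>sqrt (real n / pi)\<close>, each component is the sheet
  increment over one cell of a space-time grid. Distinct cells are uncorrelated, so joint
  Gaussianity gives independence over time steps and components at once.\<close>

lemma (in prob_space) beta_increments:
  fixes D :: "nat \<Rightarrow> 'a \<Rightarrow> real ^ ('d::{finite,linorder})"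
  assumes W: "brownian_sheet M T pi W" and T: "T > 0" and m: "m \<ge> 1"
    and n: "n \<ge> 2" "CARD('d) = n - 1"
    and D: "\<And>j \<omega>. D j \<omega> = beta n W (real (Suc j) * (T / real m)) \<omega> - beta n W (real j * (T / real m)) \<omega>"
  shows "indep_vars (\<lambda>_. borel) (\<lambda>p \<omega>. D (fst p) \<omega> \<bullet> snd p) ({..<m} \<times> Basis)"
    and "j < m \<Longrightarrow> b \<in> Basis \<Longrightarrow> \<exists>f. distributed M lborel (\<lambda>\<omega>. D j \<omega> \<bullet> b) f"
proof -
  let ?\<tau> = "T / real m" and ?S = "{0..T} \<times> {0..pi}"
  define X where "X p \<omega> = D (fst p) \<omega> \<bullet> snd p" for p \<omega>
  define R where "R j k = sheet_increment W (real j * ?\<tau>) (real (Suc j) * ?\<tau>)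
    (real (pos k) * mesh n) (real (Suc (pos k)) * mesh n)" for j and k :: 'd
  have X_eq: "X (j, axis k 1) \<omega> = sqrt (real n / pi) * R j k \<omega>" for j k \<omega>
    by (simp add: X_def D R_def inner_axis beta_def sheet_increment_def algebra_simps)
  have \<tau>0: "?\<tau> \<ge> 0" and h0: "mesh n \<ge> 0"
    using T n by (auto simp: mesh_def)
  have tm: "real j * ?\<tau> \<in> {0..T}" if "j \<le> m" for j
    using that T m mult_right_mono[of "real j" "real m" ?\<tau>] by auto
  have xm: "real j * mesh n \<in> {0..pi}" if "j \<le> n" for j
    using that n mult_right_mono[of "real j" "real n" "mesh n"] h0 by (auto simp: mesh_def)
  \<comment> \<open>The largest position is \<open>n - 1\<close>, so the last cell ends at
    \<open>n * mesh n\<close>, that is, exactly at the end point \<open>pi\<close>.\<close>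
  have pos_n: "Suc (pos k) \<le> n" for k :: 'd
    using pos_bounds[of k] n by linarith
  have R_span: "R j k \<in> sheet_span W ?S" if "j < m" for j k
    unfolding R_def using that pos_n[of k] by (intro sheet_increment_in_span tm xm) auto
  have cov: "expectation (\<lambda>\<omega>. X (j, axis k 1) \<omega> * X (j', axis k' 1) \<omega>) =
      (if j = j' \<and> k = k' then ?\<tau> else 0)" if "j < m" "j' < m" for j j' k k'
  proof -
    have "expectation (\<lambda>\<omega>. X (j, axis k 1) \<omega> * X (j', axis k' 1) \<omega>) =
      expectation (\<lambda>\<omega>. (real n / pi) * (R j k \<omega> * R j' k' \<omega>))"
      unfolding X_eq by (intro Bochner_Integration.integral_cong refl) (simp add: algebra_simps)
    also have "\<dots> = (real n / pi) * expectation (\<lambda>\<omega>. R j k \<omega> * R j' k' \<omega>)" by simp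
    also have "expectation (\<lambda>\<omega>. R j k \<omega> * R j' k' \<omega>) =
      (if j = j' then ?\<tau> else 0) * (if pos k = pos k' then mesh n else 0)"
      unfolding R_def overlap_grid[OF \<tau>0, symmetric] overlap_grid[OF h0, symmetric]
      using that pos_n[of k] pos_n[of k'] by (intro sheet_increment_covariance[OF W] tm xm) auto
    finally show ?thesis using n by (auto simp: mesh_def inj_eq[OF inj_pos])
  qed
  have X_span: "X (j, b) \<in> sheet_span W ?S" if "j < m" "b \<in> Basis" for j b
  proof -
    obtain k where b: "b = axis k 1" using \<open>b \<in> Basis\<close> by (auto simp: Basis_vec_def)
    show ?thesis
      using sheet_span_scale[OF R_span[OF that(1)], of "sqrt (real n / pi)" k] by (simp add: b X_eq[abs_def])
  qed
  have "indep_vars (\<lambda>_. borel) X ({..<m} \<times> Basis)"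
  proof (rule uncorrelated_gaussian_imp_indep)
    show "centered_gaussian M (\<lambda>\<omega>. \<Sum>i\<in>{..<m} \<times> Basis. t i * X i \<omega>)" for t
      by (intro sheet_span_gaussian[OF W] sheet_span_sum sheet_span_scale) (auto intro: X_span)
    fix p q assume "p \<in> {..<m} \<times> (Basis :: (real ^ ('d::{finite,linorder})) set)" "q \<in> {..<m} \<times> (Basis :: (real ^ ('d::{finite,linorder})) set)" "p \<noteq> q"
    then show "expectation (\<lambda>\<omega>. X p \<omega> * X q \<omega>) = 0"
      using cov by (auto simp: Basis_vec_def split: if_splits)
  qed auto
  then show "indep_vars (\<lambda>_. borel) (\<lambda>p \<omega>. D (fst p) \<omega> \<bullet> snd p) ({..<m} \<times> Basis)"
    by (simp add: X_def[abs_def])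
  assume j: "j < m" and b: "b \<in> Basis"
  obtain k where k: "b = axis k 1" using b by (auto simp: Basis_vec_def)
  have gauss: "centered_gaussian M (X (j, b))"
    by (rule sheet_span_gaussian[OF W X_span[OF j b]])
  \<comment> \<open>The second moment is the step size \<open>T / real m\<close>, which is positive.
    This rules out the degenerate alternative of \<open>centered_gaussian\<close> and leaves the one
    with a density.\<close>
  have "\<not> (AE \<omega> in M. X (j, b) \<omega> = 0)"
  proof
    assume 0: "AE \<omega> in M. X (j, b) \<omega> = 0"
    have [measurable]: "X (j, b) \<in> borel_measurable M" by (rule centered_gaussian_char(1)[OF gauss])
    have "expectation (\<lambda>\<omega>. X (j, b) \<omega> * X (j, b) \<omega>) = expectation (\<lambda>\<omega>. 0)"
      by (rule integral_cong_AE) (use 0 in auto)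
    then show False using cov[OF j j, of k k] T m by (simp add: k)
  qed
  then show "\<exists>f. distributed M lborel (\<lambda>\<omega>. D j \<omega> \<bullet> b) f"
    using gauss by (auto simp: centered_gaussian_def X_def[abs_def])
qed

section \<open>The implicit map\<close>

text \<open>Summation by parts for the second difference. The boundary terms are kept, which lets
  the induction on \<open>N\<close> go through for arbitrary \<open>g\<close>; they vanish when
  \<open>g\<close> is zero at \<open>0\<close> and at \<open>Suc N\<close>.\<close>

lemma discrete_dirichlet_form:
  fixes g :: "nat \<Rightarrow> real"
  shows "(\<Sum>j=1..N. g j * (2 * g j - g (j - 1) - g (Suc j))) =
    (\<Sum>j\<le>N. (g (Suc j) - g j)\<^sup>2) - g (Suc N) * (g (Suc N) - g N) + g 0 * (g 1 - g 0)"
  by (induction N) (auto simp: algebra_simps power2_eq_square)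

text \<open>The quadratic form is a positive multiple of the sum of squared differences of
  neighbouring components, boundary zeros included. If it vanished, all components would equal the
  boundary value zero.\<close>

lemma neg_A_mat_pos_def:
  fixes e :: "real ^ 'd::{finite,linorder}"
  assumes "n \<ge> 1" "e \<noteq> 0"
  shows "e \<bullet> (- A_mat n *v e) > 0"
proof -
  define N where "N = CARD('d)"
  define c where "c = (real n)\<^sup>2 / pi\<^sup>2"
  have c: "c > 0" using assms by (simp add: c_def)
  \<comment> \<open>Components listed by position and padded with zeros. The zeros at
    \<open>0\<close> and \<open>Suc N\<close> encode the Dirichlet condition and let the first and
    last rows of the matrix obey the same formula as the others.\<close>
  define g where "g j = (\<Sum>k\<in>UNIV. if pos k = j then e $ k else 0)" for j
  have g_pos: "g (pos k) = e $ k" for k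
    unfolding g_def by (subst inj_eq[OF inj_pos]) simp
  have g_out: "g j = 0" if "j \<notin> {1..N}" for j
    using that range_pos[where 'd='d] unfolding g_def N_def by (intro sum.neutral) auto
  have Ae: "(- A_mat n *v e) $ k = c * (2 * g (pos k) - g (pos k - 1) - g (Suc (pos k)))" for k :: 'd
  proof -
    have pk: "pos k \<ge> 1" using range_pos[where 'd='d] by auto
    have "(- A_mat n *v e) $ k = (\<Sum>l\<in>UNIV. c *
       (2 * (if pos l = pos k then e $ l else 0) - (if pos l = pos k - 1 then e $ l else 0) - (if pos l = Suc (pos k) then e $ l else 0)))"
      unfolding matrix_vector_mult_def A_mat_def using pk
      by (auto simp: c_def intro!: sum.cong)
    also have "\<dots> = c * (2 * g (pos k) - g (pos k - 1) - g (Suc (pos k)))"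
      unfolding g_def by (simp add: sum_distrib_left[symmetric] sum_subtractf)
    finally show ?thesis .
  qed
  have "e \<bullet> (- A_mat n *v e) = (\<Sum>k\<in>UNIV. c * (g (pos (k :: 'd)) * (2 * g (pos k) - g (pos k - 1) - g (Suc (pos k)))))"
    by (simp only: inner_vec_def Ae g_pos inner_real_def mult.left_commute)
  also have "\<dots> = c * (\<Sum>j=1..N. g j * (2 * g j - g (j - 1) - g (Suc j)))"
    unfolding N_def sum_over_pos[of "\<lambda>j. c * (g j * (2 * g j - g (j - 1) - g (Suc j)))"] by (simp add: sum_distrib_left)
  also have "\<dots> = c * (\<Sum>j\<le>N. (g (Suc j) - g j)\<^sup>2)"
    unfolding discrete_dirichlet_form by (simp add: g_out)
  finally have eq: "e \<bullet> (- A_mat n *v e) = c * (\<Sum>j\<le>N. (g (Suc j) - g j)\<^sup>2)" .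
  have "(\<Sum>j\<le>N. (g (Suc j) - g j)\<^sup>2) \<noteq> 0"
  proof
    assume "(\<Sum>j\<le>N. (g (Suc j) - g j)\<^sup>2) = 0"
    then have step: "g (Suc j) = g j" if "j \<le> N" for j
      using that by (subst (asm) sum_nonneg_eq_0_iff) auto
    have "g j = 0" if "j \<le> N" for j
      using that by (induction j) (auto simp: g_out step)
    then have "e $ k = 0" for k
      using range_pos[where 'd='d] by (metis N_def atLeastAtMost_iff g_pos rangeI)
    then show False using assms by (simp add: vec_eq_iff)
  qed
  moreover have "(\<Sum>j\<le>N. (g (Suc j) - g j)\<^sup>2) \<ge> 0" by (simp add: sum_nonneg)
  ultimately show ?thesis using c eq by (simp add: less_le)
qed

section \<open>The map inverted in one time step\<close>

definition implicit_map :: "nat \<Rightarrow> real \<Rightarrow> real ^ ('d::{finite,linorder}) \<Rightarrow> real ^ ('d::{finite,linorder})" where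
  "implicit_map n \<tau> x = x + \<tau> *\<^sub>R ((A_mat n ** A_mat n) *v x) - \<tau> *\<^sub>R (A_mat n *v F_vec x)"

text \<open>The components of \<open>F_vec\<close> are polynomials and the rest is linear.
  Differentiability is used twice: it gives continuity for the Borel left inverse, and it sends
  negligible sets to negligible sets.\<close>

lemma implicit_map_differentiable: "implicit_map n \<tau> differentiable_on S"
proof -
  have "polynomial_function (F_vec :: real ^ 'd \<Rightarrow> real ^ 'd)"
    unfolding polynomial_function_iff_Basis_inner
  proof
    fix b :: "real ^ 'd" assume "b \<in> Basis"
    then obtain k where b: "b = axis k 1" by (auto simp: Basis_vec_def)
    have "real_polynomial_function (\<lambda>x :: real ^ 'd. x $ k)"
      by (intro real_polynomial_function.intros(1) bounded_linear_vec_nth)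
    then show "real_polynomial_function (\<lambda>x. F_vec x \<bullet> b)"
      by (auto simp: b inner_axis F_vec_def f_nl_def)
  qed
  then have F: "F_vec differentiable (at x within S)" for x :: "real ^ 'd" and S
    by (rule differentiable_at_polynomial_function)
  have lin: "(\<lambda>x. C *v g x) differentiable (at x within S)"
    if "g differentiable (at x within S)" for C :: "real ^ 'd ^ 'd" and g :: "real ^ 'd \<Rightarrow> real ^ 'd" and x S
    using that bounded_linear.has_derivative[OF matrix_vector_mul_bounded_linear]
    unfolding differentiable_def by blast
  show ?thesis
    unfolding differentiable_on_def implicit_map_def
    by (auto intro!: derivative_intros lin F)
qed

text \<open>If \<open>d = x - y\<close> is the difference of two solutions and \<open>d = -A e\<close>, cancelling \<open>A\<close> in the
  difference of the equations and testing with \<open>d\<close> leaves \<open>e \<bullet> (-A e) \<le> \<tau> \<bar>A e\<bar>\<^sup>2\<close>, because \<open>f\<close> is one-sided Lipschitz with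
  constant 1. Compactness of the sphere turns positive definiteness of \<open>-A\<close> into a bound on \<open>\<tau>\<close>.\<close>

lemma implicit_map_inj:
  fixes n :: nat
  assumes "n \<ge> 1"
  obtains \<tau>\<^sub>0 where "\<tau>\<^sub>0 > 0"
    "\<And>\<tau>. 0 < \<tau> \<Longrightarrow> \<tau> < \<tau>\<^sub>0 \<Longrightarrow>
      inj (implicit_map n \<tau> :: real ^ ('d::{finite,linorder}) \<Rightarrow> real ^ ('d::{finite,linorder}))"
proof -
  let ?A = "A_mat n :: real ^ ('d::{finite,linorder}) ^ ('d::{finite,linorder})"
  define B where "B e = - ?A *v e" for e
  have linB: "linear B" unfolding B_def by simp
  have pd: "e \<bullet> B e > 0" if "e \<noteq> 0" for e
    using neg_A_mat_pos_def[OF assms that] by (simp add: B_def)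
  have "\<exists>e\<in>sphere 0 1. \<forall>y\<in>sphere 0 1. e \<bullet> B e \<le> y \<bullet> B y"
    using linear_continuous_on[OF linB[unfolded linear_conv_bounded_linear]]
    by (intro continuous_attains_inf) (auto intro!: continuous_intros)
  then obtain e0 where e0: "norm e0 = 1" "\<And>y. norm y = 1 \<Longrightarrow> e0 \<bullet> B e0 \<le> y \<bullet> B y"
    by auto
  define \<mu> where "\<mu> = e0 \<bullet> B e0"
  have "e0 \<noteq> 0" using e0(1) by (metis norm_zero zero_neq_one)
  then have \<mu>: "\<mu> > 0" using pd[of e0] e0(1) by (auto simp: \<mu>_def)
  have coercive: "\<mu> * (norm e)\<^sup>2 \<le> e \<bullet> B e" for e
  proof (cases "e = 0")
    case False
    have "\<mu> \<le> (e /\<^sub>R norm e) \<bullet> B (e /\<^sub>R norm e)"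
      unfolding \<mu>_def by (rule e0) (use False in simp)
    also have "\<dots> = (e \<bullet> B e) / (norm e)\<^sup>2"
      by (simp add: linear_scale[OF linB] power2_eq_square divide_inverse mult_ac)
    finally show ?thesis using False by (simp add: field_simps)
  qed (simp add: linear_0[OF linB])
  obtain K where K: "K > 0" "\<And>e. norm (B e) \<le> norm e * K"
    using bounded_linear.pos_bounded linB linear_conv_bounded_linear by blast
  have "inj B"
    unfolding linear_injective_0[OF linB] using pd by (metis inner_zero_right less_irrefl)
  then have "surj B" by (rule linear_inj_imp_surj[OF linB])
  show ?thesis
  proof
    \<comment> \<open>\<open>\<mu>\<close> is the coercivity constant of \<open>B\<close> and
      \<open>K\<close> bounds its operator norm. Below this threshold
      \<open>\<tau> * K\<^sup>2 < \<mu>\<close>, so coercivity outweighs the loss from the one-sided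
      Lipschitz bound.\<close>
    show "\<mu> / K\<^sup>2 > 0" using \<mu> K by simp
    fix \<tau> assume \<tau>: "0 < \<tau>" "\<tau> < \<mu> / K\<^sup>2"
    show "inj (implicit_map n \<tau> :: real ^ ('d::{finite,linorder}) \<Rightarrow> real ^ ('d::{finite,linorder}))"
    proof (rule injI)
      fix x y :: "real ^ ('d::{finite,linorder})" assume eq: "implicit_map n \<tau> x = implicit_map n \<tau> y"
      define d where "d = x - y"
      define \<phi> where "\<phi> = F_vec x - F_vec y"
      obtain e where e: "d = B e" using \<open>surj B\<close> by (metis surjD)
      have A_B: "?A *v z = - B z" for z by (simp add: B_def matrix_vector_mult_def vec_eq_iff sum_negf)
      have "B (e + \<tau> *\<^sub>R B d + \<tau> *\<^sub>R \<phi>) = implicit_map n \<tau> x - implicit_map n \<tau> y"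
        unfolding implicit_map_def matrix_vector_mul_assoc[symmetric] A_B
        by (simp add: d_def \<phi>_def linear_add[OF linB] linear_diff[OF linB] linear_scale[OF linB] linear_neg[OF linB] 
            e[unfolded d_def, symmetric] algebra_simps)
      then have "e + \<tau> *\<^sub>R B d + \<tau> *\<^sub>R \<phi> = 0"
        using \<open>inj B\<close> eq linear_0[OF linB] by (metis diff_self injD)
      then have "0 = (e + \<tau> *\<^sub>R B d + \<tau> *\<^sub>R \<phi>) \<bullet> d" by simp
      also have "\<dots> = e \<bullet> B e + \<tau> * (d \<bullet> B d) + \<tau> * (\<phi> \<bullet> d)"
        by (simp add: inner_add_left e inner_commute[of "B (B e)" "B e"])
      finally have 0: "0 = e \<bullet> B e + \<tau> * (d \<bullet> B d) + \<tau> * (\<phi> \<bullet> d)" .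
      have one_sided: "(f_nl a - f_nl b) * (a - b) \<ge> - (a - b)\<^sup>2" for a b
      proof -
        \<comment> \<open>The second factor is \<open>a\<^sup>2 + a * b + b\<^sup>2\<close>, the
          cofactor of \<open>a - b\<close> in the difference of cubes, with the square
          completed.\<close>
        have "(f_nl a - f_nl b) * (a - b) + (a - b)\<^sup>2 = (a - b)\<^sup>2 * ((a + b / 2)\<^sup>2 + 3 / 4 * b\<^sup>2)"
          by (simp add: f_nl_def power2_eq_square power3_eq_cube algebra_simps)
        moreover have "\<dots> \<ge> 0" by (intro mult_nonneg_nonneg add_nonneg_nonneg) auto
        ultimately show ?thesis by linarith
      qed
      have "\<phi> \<bullet> d \<ge> (\<Sum>k\<in>UNIV. - (x $ k - y $ k)\<^sup>2)"
        unfolding inner_vec_def \<phi>_def d_def F_vec_def by (intro sum_mono) (simp add: one_sided)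
      also have "(\<Sum>k\<in>UNIV. - (x $ k - y $ k)\<^sup>2) = - (norm d)\<^sup>2"
        by (simp add: d_def norm_vec_def L2_set_def sum_nonneg sum_negf)
      finally have "\<phi> \<bullet> d \<ge> - (norm d)\<^sup>2" .
      then have "\<tau> * (\<phi> \<bullet> d) \<ge> \<tau> * - (norm d)\<^sup>2"
        using \<tau>(1) by (intro mult_left_mono) auto
      \<comment> \<open>The contribution of the squared matrix has the favourable sign and is
        dropped.\<close>
      moreover have "d \<bullet> B d \<ge> 0" using pd[of d] by (cases "d = 0") auto
      then have "\<tau> * (d \<bullet> B d) \<ge> 0" using \<tau>(1) by simp
      ultimately have "\<mu> * (norm e)\<^sup>2 \<le> \<tau> * (norm d)\<^sup>2"
        using 0 coercive[of e] by simp
      also have "\<dots> \<le> \<tau> * (norm e * K)\<^sup>2"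
        using K(2)[of e] \<tau> by (intro mult_left_mono power_mono) (auto simp: e)
      finally have "(\<mu> - \<tau> * K\<^sup>2) * (norm e)\<^sup>2 \<le> 0" by (simp add: algebra_simps power_mult_distrib)
      moreover have "\<mu> - \<tau> * K\<^sup>2 > 0" using \<tau> K by (simp add: field_simps)
      ultimately have "(norm e)\<^sup>2 \<le> 0" by (simp add: mult_le_0_iff)
      then have "e = 0" by simp
      then show "x = y" using e linear_0[OF linB] by (simp add: d_def)
    qed
  qed
qed

section \<open>The scheme\<close>

text \<open>Invariance of domain makes the range open and the inverse continuous on it, so extension
  by zero stays Borel. A left inverse suffices to solve the scheme, whose right-hand side is almost
  surely a value of the implicit map.\<close>

lemma continuous_inj_borel_left_inverse:
  fixes f :: "'a::euclidean_space \<Rightarrow> 'a"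
  assumes "continuous_on UNIV f" "inj f"
  obtains g where "g \<in> borel_measurable borel" "\<And>x. g (f x) = x"
proof -
  obtain h where h: "homeomorphism UNIV (range f) f h"
    using invariance_of_domain_homeomorphism[OF open_UNIV assms(1) order_refl assms(2)] .
  have "open (range f)"
    using invariance_of_domain[OF assms(1) open_UNIV assms(2)] .
  show ?thesis
  proof
    show "(\<lambda>y. if y \<in> range f then h y else 0) \<in> borel_measurable borel"
      using h \<open>open (range f)\<close>
      by (intro borel_measurable_continuous_on_if) (auto simp: homeomorphism_def)
    show "(if f x \<in> range f then h (f x) else 0) = x" for x
      using h by (auto simp: homeomorphism_def)
  qed
qed

lemma Sigma_mat_mult: "(Sigma_mat \<sigma> v *v d) $ k = \<sigma> (v $ k) * d $ k"
  unfolding Sigma_mat_def matrix_vector_mult_def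
  by (simp add: if_distrib[of "\<lambda>x. x * _"] cong: if_cong)

lemma inj_Sigma_mat:
  assumes "c \<noteq> 0" "\<And>x. \<sigma> x \<noteq> 0"
  shows "inj (\<lambda>d. c *\<^sub>R (Sigma_mat \<sigma> v *v d))"
  using assms by (intro injI) (simp add: vec_eq_iff Sigma_mat_mult)

lemma Sigma_mat_measurable:
  fixes \<sigma> :: "real \<Rightarrow> real"
  assumes [measurable]: "\<sigma> \<in> borel_measurable borel"
  shows "(\<lambda>(v, d). c *\<^sub>R (Sigma_mat \<sigma> v *v d)) \<in>
    borel_measurable ((borel :: (real ^ 'd) measure) \<Otimes>\<^sub>M (borel :: (real ^ 'd) measure))"
proof -
  have [measurable]: "(\<lambda>x :: real ^ 'd. x $ k) \<in> borel_measurable borel" for k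
    by (intro borel_measurable_continuous_onI continuous_intros)
  have "(\<lambda>(v, d). (c *\<^sub>R (Sigma_mat \<sigma> v *v d)) \<bullet> b) \<in>
    borel_measurable ((borel :: (real ^ 'd) measure) \<Otimes>\<^sub>M (borel :: (real ^ 'd) measure))" if "b \<in> Basis" for b
  proof -
    obtain k where "b = axis k 1" using \<open>b \<in> Basis\<close> by (auto simp: Basis_vec_def)
    then show ?thesis by (simp add: inner_axis Sigma_mat_mult case_prod_beta)
  qed
  then show ?thesis
    unfolding case_prod_beta by (subst borel_measurable_euclidean_space) auto
qed

text \<open>The induction over time carries dependence on the earlier noise, not absolute
  continuity: the latter could not start, since \<open>U 0\<close> is almost surely constant.
  Absolute continuity is then obtained from the last step alone.\<close>

lemma (in prob_space) scheme_absolutely_continuous: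
  fixes U :: "nat \<Rightarrow> 'a \<Rightarrow> real ^ ('d::{finite,linorder})"
  assumes n: "n \<ge> 2" "CARD('d) = n - 1"
    and inj: "inj (implicit_map n (T / real m) :: real ^ ('d::{finite,linorder}) \<Rightarrow> real ^ ('d::{finite,linorder}))"
    and T: "T > 0" and m: "m \<ge> 1"
    and \<sigma>: "\<sigma> \<in> borel_measurable borel" "\<And>x. \<sigma> x \<noteq> 0"
    and W: "brownian_sheet M T pi W"
    and scheme: "fully_discrete_scheme M T n m \<sigma> u\<^sub>0 W U"
    and i: "i < m"
  shows "absolutely_continuous lborel (distr M lborel (U (Suc i)))"
proof -
  let ?\<tau> = "T / real m" and ?\<Phi> = "implicit_map n (T / real m) :: real ^ ('d::{finite,linorder}) \<Rightarrow> real ^ ('d::{finite,linorder})"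
  let ?past = "\<lambda>j. {..<j} \<times> (Basis :: (real ^ ('d::{finite,linorder})) set)"
  define c where "c = sqrt (real n / pi)"
  have c: "c \<noteq> 0" using n by (simp add: c_def)
  define L where "L v d = c *\<^sub>R (Sigma_mat \<sigma> v *v d)" for v d :: "real ^ ('d::{finite,linorder})"
  have L_m[measurable]: "(\<lambda>(v, d). L v d) \<in> borel_measurable (borel \<Otimes>\<^sub>M borel)"
    unfolding L_def by (rule Sigma_mat_measurable[OF \<sigma>(1)])
  define D where "D j \<omega> = (beta n W (real (Suc j) * ?\<tau>) \<omega> - beta n W (real j * ?\<tau>) \<omega> :: real ^ ('d::{finite,linorder}))" for j \<omega>
  define X where "X p \<omega> = D (fst p) \<omega> \<bullet> snd p" for p \<omega>
  have indep: "indep_vars (\<lambda>_. borel) X (?past m)"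
    and dens: "\<And>j b. j < m \<Longrightarrow> b \<in> Basis \<Longrightarrow> \<exists>f. distributed M lborel (\<lambda>\<omega>. D j \<omega> \<bullet> b) f"
    using beta_increments[OF W T m n, of D] by (auto simp: D_def X_def[abs_def])
  have U_m[measurable]: "j \<le> m \<Longrightarrow> U j \<in> borel_measurable M" for j
    using scheme by (simp add: fully_discrete_scheme_def Let_def)
  have U_0: "AE \<omega> in M. U 0 \<omega> = (\<chi> k. u\<^sub>0 (real (pos k) * mesh n))"
    using scheme by (simp add: fully_discrete_scheme_def Let_def)
  have U_Suc: "AE \<omega> in M. ?\<Phi> (U (Suc j) \<omega>) = U j \<omega> + L (U j \<omega>) (D j \<omega>)" if "j < m" for j
  proof -
    have "AE \<omega> in M. U (Suc j) \<omega> - U j \<omega> + ?\<tau> *\<^sub>R ((A_mat n ** A_mat n) *v U (Suc j) \<omega>) =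
          ?\<tau> *\<^sub>R (A_mat n *v F_vec (U (Suc j) \<omega>)) + L (U j \<omega>) (D j \<omega>)"
      using scheme that unfolding fully_discrete_scheme_def Let_def L_def D_def c_def by blast
    then show ?thesis
      by (rule AE_mp) (intro AE_I2 impI, simp add: implicit_map_def algebra_simps)
  qed
  have "continuous_on UNIV ?\<Phi>"
    by (intro differentiable_imp_continuous_on implicit_map_differentiable)
  then obtain g where g[measurable]: "g \<in> borel_measurable borel" and g_inv: "\<And>x. g (?\<Phi> x) = x"
    using continuous_inj_borel_left_inverse[OF _ inj] by blast
  define row where "row j \<eta> = (\<Sum>b\<in>Basis. \<eta> (j, b) *\<^sub>R b)" for j and \<eta> :: "nat \<times> (real ^ ('d::{finite,linorder})) \<Rightarrow> real"
  have row_X: "row j (restrict (\<lambda>p. X p \<omega>) K) = D j \<omega>" if "{j} \<times> Basis \<subseteq> K" for j K \<omega>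
  proof -
    have "row j (restrict (\<lambda>p. X p \<omega>) K) = (\<Sum>b\<in>Basis. (D j \<omega> \<bullet> b) *\<^sub>R b)"
      unfolding row_def using that by (intro sum.cong) (auto simp: X_def)
    then show ?thesis by (simp add: euclidean_representation)
  qed
  have row_m: "row j \<in> borel_measurable (PiM K (\<lambda>_. borel))" if "{j} \<times> Basis \<subseteq> K" for j K
    unfolding row_def
    by (intro borel_measurable_sum borel_measurable_scaleR measurable_component_singleton borel_measurable_const)
       (use that in auto)
  \<comment> \<open>Each state is written as a Borel function of the finitely many earlier noise
    coordinates, the form from which independence can be read off. Equality is almost sure, as are
    the equations of the scheme.\<close>
  have past: "\<exists>G \<in> borel_measurable (PiM (?past j) (\<lambda>_. borel)).
      AE \<omega> in M. U j \<omega> = G (restrict (\<lambda>p. X p \<omega>) (?past j))" if "j \<le> m" for j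
    using that
  proof (induction j)
    case 0
    show ?case using U_0 by (intro bexI[of _ "\<lambda>_. \<chi> k. u\<^sub>0 (real (pos k) * mesh n)"]) auto
  next
    case (Suc j)
    then obtain G where G: "G \<in> borel_measurable (PiM (?past j) (\<lambda>_. borel))"
      and U_j: "AE \<omega> in M. U j \<omega> = G (restrict (\<lambda>p. X p \<omega>) (?past j))"
      by (meson Suc_leD)
    have "(\<lambda>\<eta>. restrict \<eta> (?past j)) \<in> measurable (PiM (?past (Suc j)) (\<lambda>_. borel)) (PiM (?past j) (\<lambda>_. borel :: real measure))"
      by (rule measurable_restrict_subset) auto
    from measurable_compose[OF this G]
    have [measurable]: "(\<lambda>\<eta>. G (restrict \<eta> (?past j))) \<in> borel_measurable (PiM (?past (Suc j)) (\<lambda>_. borel))" .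
    have [measurable]: "row j \<in> borel_measurable (PiM (?past (Suc j)) (\<lambda>_. borel))"
      by (rule row_m) auto
    have [measurable]: "(\<lambda>\<eta>. L (G (restrict \<eta> (?past j))) (row j \<eta>)) \<in> borel_measurable (PiM (?past (Suc j)) (\<lambda>_. borel))"
      using measurable_compose[OF measurable_Pair[of "\<lambda>\<eta>. G (restrict \<eta> (?past j))" _ borel "row j" borel] L_m] by simp
    have rest: "restrict (restrict (\<lambda>p. X p \<omega>) (?past (Suc j))) (?past j) = restrict (\<lambda>p. X p \<omega>) (?past j)" for \<omega>
      by (auto simp: fun_eq_iff restrict_def)
    have row_j: "row j (restrict (\<lambda>p. X p \<omega>) (?past (Suc j))) = D j \<omega>" for \<omega>
      by (rule row_X) auto
    have "AE \<omega> in M. U (Suc j) \<omega> = (\<lambda>\<eta>. g (G (restrict \<eta> (?past j)) + L (G (restrict \<eta> (?past j))) (row j \<eta>)))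
        (restrict (\<lambda>p. X p \<omega>) (?past (Suc j)))"
      using U_j U_Suc[OF Suc_le_lessD[OF Suc.prems]]
    proof eventually_elim
      case (elim \<omega>)
      show ?case unfolding rest row_j elim(1)[symmetric] elim(2)[symmetric] by (simp only: g_inv)
    qed
    moreover have "(\<lambda>\<eta>. g (G (restrict \<eta> (?past j)) + L (G (restrict \<eta> (?past j))) (row j \<eta>))) \<in>
        borel_measurable (PiM (?past (Suc j)) (\<lambda>_. borel))"
      by (rule measurable_compose[OF borel_measurable_add g]) measurable
    ultimately show ?case by (rule bexI)
  qed
  obtain G where G: "G \<in> borel_measurable (PiM (?past i) (\<lambda>_. borel))"
    and U_i: "AE \<omega> in M. U i \<omega> = G (restrict (\<lambda>p. X p \<omega>) (?past i))"
    using past[of i] i by auto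
  \<comment> \<open>\<open>V\<close> is an everywhere defined function of the earlier noise that
    agrees almost surely with \<open>U i\<close>; independence is proved for
    \<open>V\<close>.\<close>
  define V where "V \<omega> = G (restrict (\<lambda>p. X p \<omega>) (?past i))" for \<omega>
  have VD: "indep_var borel V borel (D i)"
  proof -
    have "indep_var borel (G \<circ> (\<lambda>\<omega>. restrict (\<lambda>p. X p \<omega>) (?past i)))
       borel (row i \<circ> (\<lambda>\<omega>. restrict (\<lambda>p. X p \<omega>) ({i} \<times> Basis)))"
      using i by (intro indep_var_compose[OF indep_var_restrict[OF indep] G row_m]) auto
    then show ?thesis by (simp add: V_def[abs_def] comp_def row_X)
  qed
  have D_ac: "absolutely_continuous lborel (distr M borel (D i))"
  proof (rule indep_components_absolutely_continuous)
    show "D i \<in> borel_measurable M" using VD by (rule indep_var_rv2)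
    \<comment> \<open>Singleton blocks pass from the family indexed by pairs of time step and
      direction to the directions of step \<open>i\<close> alone.\<close>
    have "indep_vars (\<lambda>b. PiM {(i, b)} (\<lambda>_. borel)) (\<lambda>b \<omega>. restrict (\<lambda>p. X p \<omega>) {(i, b)}) Basis"
      by (rule indep_vars_restrict[OF indep]) (use i in \<open>auto simp: disjoint_family_on_def\<close>)
    then have "indep_vars (\<lambda>_. borel) (\<lambda>b \<omega>. (\<lambda>\<eta>. \<eta> (i, b)) (restrict (\<lambda>p. X p \<omega>) {(i, b)})) Basis"
      by (rule indep_vars_compose2) auto
    then show "indep_vars (\<lambda>_. borel) (\<lambda>b \<omega>. D i \<omega> \<bullet> b) Basis" by (simp add: X_def)
  qed (use dens i in auto)
  show ?thesis
    unfolding absolutely_continuous_def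
  proof
    fix N :: "(real ^ ('d::{finite,linorder})) set" assume N: "N \<in> null_sets lborel"
    then have Nb[measurable]: "N \<in> sets borel" by auto
    have "negligible N" using N null_sets_lborel_iff_negligible[OF Nb] by simp
    then have "negligible (?\<Phi> ` N)"
      by (intro negligible_differentiable_image_negligible order_refl implicit_map_differentiable)
    \<comment> \<open>The image is known only to be negligible, so it is enclosed in a Borel null
      set before the avoidance lemma is applied.\<close>
    then have "\<exists>N'\<in>null_sets lborel. ?\<Phi> ` N \<subseteq> N'"
      by (simp only: negligible_iff_null_sets null_sets_completion_iff2)
    then obtain N' where N': "N' \<in> null_sets lborel" "?\<Phi> ` N \<subseteq> N'" ..
    have "AE \<omega> in M. V \<omega> + L (V \<omega>) (D i \<omega>) \<notin> N'"
    proof (rule state_dependent_noise_avoids_null_set[OF VD D_ac _ _ L_m N'(1)])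
      show "linear (L v)" for v
        unfolding L_def by (intro linear_compose_scale_right) simp
      show "inj (L v)" for v
        unfolding L_def by (rule inj_Sigma_mat[OF c \<sigma>(2)])
    qed
    then have "AE \<omega> in M. U (Suc i) \<omega> \<notin> N"
      using U_i U_Suc[OF i]
    proof eventually_elim
      case (elim \<omega>)
      then show ?case using N'(2) by (auto simp: V_def[symmetric])
    qed
    then have "emeasure M (U (Suc i) -` N \<inter> space M) = 0"
      using i by (subst (asm) AE_iff_measurable[OF _ refl]) (auto simp: vimage_def Int_def conj_commute)
    then show "N \<in> null_sets (distr M lborel (U (Suc i)))"
      using i by (simp add: null_sets_def emeasure_distr)
  qed
qed

text \<open>The threshold comes solely from injectivity of the implicit map, which involves neither
  the noise nor \<open>\<sigma>\<close>; hence it can be chosen before the probability space,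
  \<open>T\<close> and \<open>m\<close>.\<close>

theorem theorem2p6:
  fixes n :: nat
  assumes "n \<ge> 2" and "CARD('d::{finite,linorder}) = n - 1"
  shows "\<exists>\<tau>\<^sub>0>0. \<forall>(M :: 'a measure) (T :: real) (\<sigma> :: real \<Rightarrow> real) (u\<^sub>0 :: real \<Rightarrow> real)
           (W :: real \<Rightarrow> real \<Rightarrow> 'a \<Rightarrow> real) (m :: nat) (U :: nat \<Rightarrow> 'a \<Rightarrow> real ^ ('d::{finite,linorder})).
           prob_space M \<longrightarrow>
           T > 0 \<longrightarrow>
           bounded (range \<sigma>) \<longrightarrow>
           (\<exists>L. L-lipschitz_on UNIV \<sigma>) \<longrightarrow>
           \<sigma> C1_differentiable_on UNIV \<longrightarrow>
           (\<forall>x. \<sigma> x \<noteq> 0) \<longrightarrow>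
           continuous_on {0<..<pi} u\<^sub>0 \<longrightarrow>
           brownian_sheet M T pi W \<longrightarrow>
           m \<ge> 1 \<longrightarrow>
           T / real m < \<tau>\<^sub>0 \<longrightarrow>
           fully_discrete_scheme M T n m \<sigma> u\<^sub>0 W U \<longrightarrow>
           (\<forall>i\<in>{1..m}. absolutely_continuous lborel (distr M lborel (U i)))"
proof -
  have "n \<ge> 1" using assms by simp
  from implicit_map_inj[OF this] obtain \<tau>\<^sub>0 where \<tau>\<^sub>0: "\<tau>\<^sub>0 > 0"
    "\<And>\<tau>. 0 < \<tau> \<Longrightarrow> \<tau> < \<tau>\<^sub>0 \<Longrightarrow> inj (implicit_map n \<tau> :: real ^ ('d::{finite,linorder}) \<Rightarrow> real ^ ('d::{finite,linorder}))"
    by blast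
  show ?thesis
  proof (intro exI[of _ \<tau>\<^sub>0] conjI allI impI ballI)
    fix M :: "'a measure" and T :: real and \<sigma> u\<^sub>0 :: "real \<Rightarrow> real" and W :: "real \<Rightarrow> real \<Rightarrow> 'a \<Rightarrow> real"
      and m i :: nat and U :: "nat \<Rightarrow> 'a \<Rightarrow> real ^ ('d::{finite,linorder})"
    assume M: "prob_space M" and T: "T > 0" and lip: "\<exists>L. L-lipschitz_on UNIV \<sigma>" and \<sigma>: "\<forall>x. \<sigma> x \<noteq> 0"
      and W: "brownian_sheet M T pi W" and m: "m \<ge> 1" and small: "T / real m < \<tau>\<^sub>0"
      and scheme: "fully_discrete_scheme M T n m \<sigma> u\<^sub>0 W U" and i: "i \<in> {1..m}"
    have "\<sigma> \<in> borel_measurable borel"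
      using lip by (intro borel_measurable_continuous_onI) (auto intro: lipschitz_on_continuous_on)
    moreover have "inj (implicit_map n (T / real m) :: real ^ ('d::{finite,linorder}) \<Rightarrow> real ^ ('d::{finite,linorder}))"
      using T m small by (intro \<tau>\<^sub>0(2)) auto
    moreover have "i - 1 < m" "Suc (i - 1) = i" using i by auto
    ultimately show "absolutely_continuous lborel (distr M lborel (U i))"
      using prob_space.scheme_absolutely_continuous[OF M assms _ T m _ _ W scheme, of "i - 1"] \<sigma> by simp
  qed (use \<tau>\<^sub>0 in auto)
qed

end
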